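(* Let $q=p^f$ be a power of a prime $p$, let $s<0$ be an integer and $d\ge 0$, and assume $S_d(s)\neq 0$. Write $$S_d(s)=(-1)^d\sum_{(m_0,\ldots,m_d)\in U_d(-s)}\binom{-s}{m_0,\ldots,m_d}\,t^{\,dm_0+(d-1)m_1+\cdots+m_{d-1}}.$$ Then the summand corresponding to the modest element of $U_d(-s)$ attains the unique minimum degree in $t$ among all summands of this sum; i.e. if $(M_0,\ldots,M_d)$ is the modest element of $U_d(-s)$, then $dM_0+(d-1)M_1+\cdots+M_{d-1}<dm_0+(d-1)m_1+\cdots+m_{d-1}$ for every other $(m_0,\ldots,m_d)\in U_d(-s)$.
   Context: $\mathbb{F}_q$ is the field with $q=p^f$ elements, $A=\mathbb{F}_q[t]$, and $A_{d+}$ is the set of monic polynomials in $A$ of degree $d$. For $d\ge0$ and $s\in\mathbb{Z}$, $S_d(s)=\sum_{a\in A_{d+}}a^{-s}$; for $s<0$ this lies in $A$. An integer is $q$-even if it is divisible by $q-1$. $\mathbb{N}=\{0,1,2,\ldots\}$. For $k>0$, $d\ge 0$, $U_d(k)$ is the set of $(m_0,\ldots,m_d)\in\mathbb{N}^{d+1}$ such that $k=\sum_i m_i$ with no carry-over of digits in base $p$ (i.e. the base-$p$ digits of the $m_i$ add digitwise, without carries, to those of $k$) and $m_i>0$ is $q$-even for $1\le i\le d$. By expanding $a=t^d+\theta_1t^{d-1}+\cdots+\theta_d$ and using Lucas' theorem one has, for $s<0$, the displayed identity, in which all multinomial coefficients are nonzero modulo $p$. An element $(M_0,\ldots,M_d)\in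 U_d(k)$ is called modest if its reverse $(M_d,M_{d-1},\ldots,M_0)$ is lexicographically the largest among reverses of elements of $U_d(k)$; it exists and is unique whenever $U_d(k)\ne\emptyset$. *)

theory Defs
  imports
    "HOL-Computational_Algebra.Computational_Algebra"
    "HOL-Library.Cardinality"
begin

text \<open>
  The finite field \<open>\<F>\<^sub>q\<close> is a type \<open>'a\<close> of classes \<open>field\<close> and \<open>finite\<close>, so that
  \<open>\<F>\<^sub>q[t]\<close> is \<open>'a poly\<close> and \<open>\<F>\<^sub>q(t)\<close> is \<open>'a poly fract\<close>.
  A tuple \<open>(m\<^sub>0, \<dots>, m\<^sub>d)\<close> is a list of length \<open>d + 1\<close>.
\<close>

definition monics :: "nat \<Rightarrow> 'a::field poly set" where
  "monics d = {a. degree a = d \<and> lead_coeff a = 1}"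

text \<open>The exponent is an arbitrary integer, hence the values lie in \<open>\<F>\<^sub>q(t)\<close>.\<close>

definition power_sum :: "nat \<Rightarrow> int \<Rightarrow> 'a::{field,finite} poly fract" where
  "power_sum d s = (\<Sum>a\<in>monics d. to_fract a powi (- s))"

definition digit :: "nat \<Rightarrow> nat \<Rightarrow> nat \<Rightarrow> nat" where
  "digit p n i = (n div p ^ i) mod p"

text \<open>
  The right-hand side of the digit condition is smaller than \<open>p\<close>, so the digitwise sums
  never produce a carry.
\<close>

definition sums_without_carry :: "nat \<Rightarrow> nat list \<Rightarrow> nat \<Rightarrow> bool" where
  "sums_without_carry p m k \<longleftrightarrow>
     sum_list m = k \<and> (\<forall>i. (\<Sum>x\<leftarrow>m. digit p x i) = digit p k i)"

definition U_set :: "nat \<Rightarrow> nat \<Rightarrow> nat \<Rightarrow> nat \<Rightarrow> nat list set" where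
  "U_set p q d k =
     {m. length m = d + 1 \<and> sums_without_carry p m k \<and>
         (\<forall>i\<in>{1..d}. m ! i > 0 \<and> (q - 1) dvd m ! i)}"

text \<open>On lists of equal length \<open>lexord less_than\<close> is the strict lexicographic order.\<close>

definition modest :: "nat \<Rightarrow> nat \<Rightarrow> nat \<Rightarrow> nat \<Rightarrow> nat list \<Rightarrow> bool" where
  "modest p q d k M \<longleftrightarrow>
     M \<in> U_set p q d k \<and>
     (\<forall>m\<in>U_set p q d k. m \<noteq> M \<longrightarrow> (rev m, rev M) \<in> lexord less_than)"

definition multinomial :: "nat \<Rightarrow> nat list \<Rightarrow> nat" where
  "multinomial k m = fact k div (\<Prod>x\<leftarrow>m. fact x)"

definition t_exponent :: "nat \<Rightarrow> nat list \<Rightarrow> nat" where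
  "t_exponent d m = (\<Sum>i<d. (d - i) * m ! i)"

definition summand :: "nat \<Rightarrow> nat \<Rightarrow> nat list \<Rightarrow> 'a::field poly" where
  "summand d k m = monom (of_nat (multinomial k m)) (t_exponent d m)"

end

theory Submission
  imports Defs
begin

text \<open>
  Minimising the degree means maximising \<open>\<Sum> i m\<^sub>i\<close>, the sum of the partial sums
  \<open>T\<^sub>s = m\<^sub>d + \<dots> + m\<^bsub>d-s\<^esub>\<close> for \<open>s < d\<close>. Sort the digits of \<open>k\<close> into classes according to
  their position modulo \<open>f\<close>. A selection of digits with \<open>v\<^sub>e\<close> digits in class \<open>e\<close> is \<open>q\<close>-even iff
  \<open>v\<^sub>e = p c\<^bsub>e+1\<^esub> - c\<^sub>e\<close> for an integer vector \<open>c\<close> of period \<open>f\<close>, and \<open>c \<ge> 1\<close> if it is nonzero.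
  In these coordinates all constraints have the form \<open>a x - b y \<le> r\<close> with \<open>a, b \<ge> 0\<close>, so that
  admissible vectors are closed under componentwise maxima and minima, and the largest value of a
  selection with given \<open>c\<close> is a supermodular function of \<open>c\<close>.

  One may relax the nesting of the \<open>T\<^sub>s\<close> to the condition that consecutive coordinate vectors differ
  by at least \<open>1\<close>: an optimal relaxed chain with minimal coordinates is nested. If the bottom
  selection \<open>T\<^sub>0\<close> of an optimal relaxed chain were not the largest possible one, then some digit
  \<open>y\<close> could be gained for \<open>T\<^sub>0\<close> at the cost of a single smaller digit \<open>z\<close>. Adapting \<open>T\<^sub>s\<close>
  to this change loses at most a digit \<open>z / 2\<^sup>s\<close>, because it already contains \<open>s (p - 1)\<close>
  further digits of the class of \<open>z\<close>; as \<open>\<Sum> z / 2\<^sup>s < 2 z \<le> y\<close>, the change is an improvement.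
  Hence an optimal tuple has the largest possible last entry, and induction on \<open>d\<close> identifies it
  with the modest one.
\<close>


section \<open>Preliminaries\<close>

lemma digit_Suc: "digit p k (Suc i) = digit p (k div p) i"
  by (simp add: digit_def div_mult2_eq)

lemma digit_0: "digit p k 0 = k mod p"
  by (simp add: digit_def)

lemma digit_of_0: "digit p 0 i = 0"
  by (simp add: digit_def)

lemma digitwise_le_div:
  "(\<forall>i. digit p j i \<le> digit p k i) \<longleftrightarrow>
     j mod p \<le> k mod p \<and> (\<forall>i. digit p (j div p) i \<le> digit p (k div p) i)"
  by (metis digit_0 digit_Suc not0_implies_Suc)

text \<open>Digitwise domination rules out borrowing, so quotient and remainder by \<open>p\<close>
  both commute with the subtraction; induction strips the lowest digit.\<close>

lemma digitwise_le_diff: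
  assumes "2 \<le> p" "\<forall>i. digit p j i \<le> digit p k i"
  shows "j \<le> k \<and> (\<forall>i. digit p (k - j) i = digit p k i - digit p j i)"
  using assms(2)
proof (induction k arbitrary: j rule: less_induct)
  case (less k)
  show ?case
  proof (cases "k div p < k")
    case True
    have m: "j mod p \<le> k mod p" and h: "\<forall>i. digit p (j div p) i \<le> digit p (k div p) i"
      using less.prems digitwise_le_div by blast+
    have IH: "j div p \<le> k div p" "\<And>i. digit p (k div p - j div p) i = digit p (k div p) i - digit p (j div p) i"
      using less.IH[OF True h] by auto
    have "p * (j div p) \<le> p * (k div p)" using IH(1) by simp
    then have jk: "j \<le> k" using m by (metis add_mono mult_div_mod_eq)
    have "k - j = p * (k div p - j div p) + (k mod p - j mod p)"
      using m \<open>p * (j div p) \<le> p * (k div p)\<close> mult_div_mod_eq[of p k] mult_div_mod_eq[of p j]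
      by (simp add: diff_mult_distrib2)
    moreover have "k mod p - j mod p < p"
      using assms(1) by (metis less_imp_diff_less mod_less_divisor not_numeral_le_zero bot_nat_0.not_eq_extremum)
    ultimately have d: "(k - j) div p = k div p - j div p" "(k - j) mod p = k mod p - j mod p"
      by simp_all
    have "digit p (k - j) i = digit p k i - digit p j i" for i
      by (cases i) (simp_all add: digit_0 digit_Suc d IH(2))
    then show ?thesis using jk by blast
  next
    case False
    then have k0: "k = 0" using assms(1) by (metis One_nat_def Suc_1 Suc_le_lessD div_less_dividend neq0_conv)
    \<comment> \<open>All digits of \<open>j\<close> are zero, so every power of \<open>p\<close>
      divides \<open>j\<close>; but \<open>p ^ j\<close> already exceeds \<open>j\<close>.\<close>
    have "j = 0"
    proof (rule ccontr)
      assume "j \<noteq> 0"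
      have z: "digit p j i = 0" for i using less.prems k0 by (simp add: digit_of_0)
      have "j mod p ^ n = 0" for n
      proof (induction n)
        case (Suc n)
        have "j mod p ^ Suc n = p ^ n * (j div p ^ n mod p) + j mod p ^ n"
          using mod_mult2_eq[of j "p ^ n" p] by (simp add: mult.commute)
        then show ?case using Suc z[of n] by (simp add: digit_def)
      qed simp
      moreover have "j < p ^ j" using assms(1) by (simp add: power_gt_expt)
      ultimately show False using \<open>j \<noteq> 0\<close> by (metis mod_less)
    qed
    then show ?thesis using k0 by (simp add: digit_of_0)
  qed
qed

lemma sum_digits: "(\<Sum>i<n. digit p k i * p ^ i) = k mod p ^ n"
proof (induction n)
  case (Suc n)
  have "k mod p ^ Suc n = p ^ n * (k div p ^ n mod p) + k mod p ^ n"
    using mod_mult2_eq[of k "p ^ n" p] by (simp add: mult.commute)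
  then show ?case using Suc by (simp add: digit_def)
qed simp

lemma digit_sum_powers:
  assumes "\<And>i. x i < p"
  shows "digit p (\<Sum>i<n. x i * p ^ i) j = (if j < n then x j else 0)"
  using assms
proof (induction n arbitrary: x j)
  case 0 then show ?case by (simp add: digit_def)
next
  case (Suc n)
  have s: "(\<Sum>i<Suc n. x i * p ^ i) = x 0 + p * (\<Sum>i<n. x (Suc i) * p ^ i)"
    by (subst sum.lessThan_Suc_shift) (simp add: sum_distrib_left mult_ac)
  show ?case
  proof (cases j)
    case 0 then show ?thesis using Suc.prems[of 0] unfolding s by (simp add: digit_0)
  next
    case (Suc j')
    have "(x 0 + p * (\<Sum>i<n. x (Suc i) * p ^ i)) div p = (\<Sum>i<n. x (Suc i) * p ^ i)"
      using Suc.prems[of 0] by (subst div_mult_self2) auto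
    then show ?thesis unfolding s Suc digit_Suc using Suc.IH[of "\<lambda>i. x (Suc i)"] Suc.prems by simp
  qed
qed

text \<open>Denominator-free form of summing losses of at most \<open>z / 2 ^ s\<close>: the total
  is at least \<open>- 2 z (1 - 2^-d)\<close>.\<close>

lemma geometric_loss_bound:
  fixes T :: "nat \<Rightarrow> int"
  assumes "\<And>s. s < d \<Longrightarrow> - z \<le> 2 ^ s * T s"
  shows "- (2 * (2 ^ d - 1)) * z \<le> 2 ^ d * (\<Sum>s<d. T s)"
  using assms
proof (induction d)
  case (Suc d)
  have "- (2 * (2 ^ d - 1)) * z \<le> 2 ^ d * (\<Sum>s<d. T s)"
    using Suc by simp
  moreover have "- z \<le> 2 ^ d * T d" using Suc.prems by simp
  ultimately show ?case by (simp add: algebra_simps)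
qed simp

section \<open>Periodic integer vectors and least closures\<close>

definition periodic :: "nat \<Rightarrow> (nat \<Rightarrow> int) \<Rightarrow> bool" where
  "periodic f c \<longleftrightarrow> (\<forall>i. c (i + f) = c i)"

lemma periodicD: "periodic f c \<Longrightarrow> c (i + f) = c i"
  by (simp add: periodic_def)

lemma periodic_add_mult: "periodic f c \<Longrightarrow> c (i + n * f) = c i"
proof (induction n)
  case (Suc n)
  have "c (i + Suc n * f) = c ((i + n * f) + f)" by (simp add: algebra_simps)
  then show ?case using Suc by (simp add: periodicD)
qed simp

lemma periodic_mod:
  assumes "periodic f c"
  shows "c (i mod f) = c i"
  using periodic_add_mult[OF assms, of "i mod f" "i div f"] by simp

lemma periodic_cong:
  assumes "periodic f c" "i mod f = j mod f"
  shows "c i = c j"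
  by (metis assms periodic_mod)

lemma mod_eq_obtain_mult:
  fixes i j f :: nat
  assumes "i \<le> j" "i mod f = j mod f"
  obtains n where "j = i + n * f"
proof -
  have "f dvd j - i" using assms by (metis mod_eq_dvd_iff_nat)
  then obtain n where "j - i = f * n" by (elim dvdE)
  then have "j = i + n * f" using assms(1) by (simp add: algebra_simps)
  then show ?thesis using that by blast
qed

text \<open>The closure inequality bounds \<open>p * y (e + 1) - y e\<close>, later the number of
  digits in class \<open>e\<close>, by \<open>V e\<close>. By the last clause a coordinate is either
  inherited from \<open>x\<close> or meets this bound with equality, so the effect of closing on the
  counts can be read off.\<close>

definition least_closed :: "nat \<Rightarrow> int \<Rightarrow> (nat \<Rightarrow> int) \<Rightarrow> (nat \<Rightarrow> int) \<Rightarrow> (nat \<Rightarrow> int) \<Rightarrow> bool" where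
  "least_closed f p V x y \<longleftrightarrow>
     periodic f y \<and> (\<forall>e. x e \<le> y e) \<and> (\<forall>e. p * y (e + 1) - V e \<le> y e) \<and>
     (\<forall>u. periodic f u \<longrightarrow> (\<forall>e. x e \<le> u e) \<longrightarrow> (\<forall>e. p * u (e + 1) - V e \<le> u e)
        \<longrightarrow> (\<forall>e. y e \<le> u e)) \<and>
     (\<forall>e. y e = x e \<or> y e = p * y (e + 1) - V e)"

lemma least_closedD:
  assumes "least_closed f p V x y"
  shows "periodic f y" "x e \<le> y e" "p * y (e + 1) - V e \<le> y e"
    "y e = x e \<or> y e = p * y (e + 1) - V e"
  using assms unfolding least_closed_def by blast+

lemma least_closed_le:
  assumes "least_closed f p V x y" "periodic f u" "\<And>e. x e \<le> u e" "\<And>e. p * u (e + 1) - V e \<le> u e"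
  shows "y e \<le> u e"
  using assms unfolding least_closed_def by blast

text \<open>The competitors are bounded below by \<open>x\<close>, and \<open>u\<close> is one of
  them. As \<open>0 \<le> p\<close>, pointwise minima of competitors are competitors, so the
  pointwise least values work; a coordinate with slack in both bounds could be lowered.\<close>

lemma ex_least_closed:
  fixes x u V :: "nat \<Rightarrow> int" and p :: int
  assumes "periodic f x" "periodic f u" "periodic f V" and "0 \<le> p"
    and "\<And>e. x e \<le> u e" and "\<And>e. p * u (e + 1) - V e \<le> u e"
  shows "\<exists>y. least_closed f p V x y"
proof -
  define S where "S = {u. periodic f u \<and> (\<forall>e. x e \<le> u e) \<and> (\<forall>e. p * u (e + 1) - V e \<le> u e)}"
  have uS: "u \<in> S" using assms by (auto simp: S_def)
  \<comment> \<open>Minimising the excess over \<open>x\<close> turns an integer minimum into a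
    least natural number. The minimiser may vary with \<open>e\<close>.\<close>
  define n where "n e = (LEAST n. \<exists>u\<in>S. u e = x e + int n)" for e
  define y where "y e = x e + int (n e)" for e
  have ex: "\<exists>n. \<exists>u\<in>S. u e = x e + int n" for e
  proof -
    have "u e = x e + int (nat (u e - x e))" using assms(5)[of e] by simp
    then show ?thesis using uS by blast
  qed
  have att: "\<exists>u\<in>S. u e = y e" for e
    using LeastI_ex[OF ex[of e]] by (auto simp: n_def y_def)
  have le: "y e \<le> u' e" if "u' \<in> S" for u' e
  proof -
    have "x e \<le> u' e" using that by (simp add: S_def)
    then have "u' e = x e + int (nat (u' e - x e))" by simp
    then have "n e \<le> nat (u' e - x e)"
      unfolding n_def using that by (intro Least_le) blast
    then show ?thesis using \<open>x e \<le> u' e\<close> by (simp add: y_def)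
  qed
  have per: "periodic f y"
    unfolding periodic_def
  proof
    fix i
    have "\<forall>u\<in>S. u (i + f) = u i" by (auto simp: S_def periodicD)
    then show "y (i + f) = y i"
      by (metis att le order_antisym)
  qed
  have xy: "x e \<le> y e" for e by (simp add: y_def)
  have cl: "p * y (e + 1) - V e \<le> y e" for e
  proof -
    obtain v where v: "v \<in> S" "v e = y e" using att by blast
    have "p * y (e + 1) \<le> p * v (e + 1)"
      using le[OF v(1), of "e + 1"] assms(4) by (rule mult_left_mono)
    moreover have "p * v (e + 1) - V e \<le> v e" using v(1) by (simp add: S_def)
    ultimately show ?thesis using v(2) by linarith
  qed
  have tight: "y e = x e \<or> y e = p * y (e + 1) - V e" for e
  proof (rule ccontr)
    assume "\<not> ?thesis"
    then have a: "x e \<le> y e - 1" "p * y (e + 1) - V e \<le> y e - 1"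
      using xy[of e] cl[of e] by auto
    \<comment> \<open>The whole residue class is lowered so that the period is kept.\<close>
    define y' where "y' i = (if i mod f = e mod f then y i - 1 else y i)" for i
    have y'le: "y' i \<le> y i" for i by (simp add: y'_def)
    have "y' \<in> S"
      unfolding S_def
    proof (intro CollectI conjI allI)
      show "periodic f y'" using per by (auto simp: periodic_def y'_def)
      fix i
      show "x i \<le> y' i"
        using a(1) xy[of i] periodic_cong[OF assms(1), of i e] periodic_cong[OF per, of i e]
        by (auto simp: y'_def)
      have "p * y' (i + 1) \<le> p * y (i + 1)" using y'le assms(4) by (rule mult_left_mono)
      moreover have "p * y (i + 1) - V i \<le> y' i"
      proof (cases "i mod f = e mod f")
        case True
        then have "(i + 1) mod f = (e + 1) mod f" by (metis mod_add_left_eq)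
        then have "y (i + 1) = y (e + 1)" using periodic_cong[OF per] by blast
        moreover have "V i = V e" "y i = y e"
          using True periodic_cong[OF per] periodic_cong[OF assms(3)] by blast+
        ultimately show ?thesis using a(2) True by (simp add: y'_def)
      next
        case False then show ?thesis using cl[of i] by (simp add: y'_def)
      qed
      ultimately show "p * y' (i + 1) - V i \<le> y' i" by linarith
    qed
    from le[OF this, of e] show False by (simp add: y'_def)
  qed
  have "y e \<le> v e" if "periodic f v" "\<forall>e. x e \<le> v e" "\<forall>e. p * v (e + 1) - V e \<le> v e" for v e
    using that by (intro le) (simp add: S_def)
  then show ?thesis
    unfolding least_closed_def using per xy cl tight by blast
qed

text \<open>\<open>b\<close> marks the run of positive entries of \<open>g\<close> that starts at
  \<open>j + 1\<close>. By periodicity the run goes all the way round or stops at some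
  \<open>e0\<close> before returning to \<open>j\<close>. In the second case
  \<open>p * b (e + 1) - b e\<close> is negative in the class of \<open>e0\<close> only.\<close>

lemma ex_run_indicator:
  fixes g :: "nat \<Rightarrow> int"
  assumes "periodic f g" "0 < f" "\<And>e. 0 \<le> g e" "1 \<le> g (j + 1)"
  obtains b :: "nat \<Rightarrow> int" where "periodic f b" "\<And>e. b e = 0 \<or> b e = 1" "\<And>e. b e \<le> g e"
    "b (j + 1) = 1"
    "(\<forall>e. b e = 1) \<or>
     (\<exists>e0. b j = 0 \<and> b e0 = 1 \<and> g e0 \<ge> 1 \<and> g (e0 + 1) = 0 \<and>
        (\<forall>e. b e = 1 \<longrightarrow> b (e + 1) = 0 \<longrightarrow> e mod f = e0 mod f))"
proof (cases "\<forall>t. g (j + 1 + t) \<noteq> 0")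
  case True
  have "g e \<ge> 1" for e
  proof -
    have "g e = g (e + (j + 1) * f)" by (rule periodic_add_mult[OF assms(1), symmetric])
    moreover have "\<exists>t. e + (j + 1) * f = j + 1 + t"
      using assms(2) by (metis le_add2 le_iff_add le_trans mult_le_mono2 nat_mult_1_right
          Suc_leI One_nat_def)
    ultimately have "g e \<noteq> 0" using True by metis
    then show ?thesis using assms(3)[of e] by linarith
  qed
  then show ?thesis using that[of "\<lambda>_. 1"] by (auto simp: periodic_def)
next
  case False
  define n where "n = (LEAST t. g (j + 1 + t) = 0)"
  have n0: "g (j + 1 + n) = 0" unfolding n_def using False by (metis (mono_tags, lifting) LeastI)
  have nmin: "g (j + 1 + t) \<ge> 1" if "t < n" for t
  proof -
    have "g (j + 1 + t) \<noteq> 0" using that not_less_Least unfolding n_def by blast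
    then show ?thesis using assms(3)[of "j + 1 + t"] by linarith
  qed
  have npos: "n > 0" using n0 assms(4) by (cases n) auto
  \<comment> \<open>A first zero at distance \<open>f\<close> would contradict
    \<open>1 \<le> g (j + 1)\<close>; one further away would repeat an earlier zero.\<close>
  have nf: "n < f"
  proof (rule ccontr)
    assume "\<not> n < f"
    show False
    proof (cases "n = f")
      case True
      then have "g (j + 1 + n) = g (j + 1)" by (simp only: periodicD[OF assms(1)])
      then show False using n0 assms(4) by simp
    next
      case False
      then have "n - f < n" "f \<le> n" using \<open>\<not> n < f\<close> assms(2) by auto
      then have "g (j + 1 + (n - f)) = g (j + 1 + n)"
        using periodicD[OF assms(1), of "j + 1 + (n - f)"] by (simp add: algebra_simps)
      then show False using nmin[of "n - f"] \<open>n - f < n\<close> n0 by simp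
    qed
  qed
  define b :: "nat \<Rightarrow> int" where
    "b e = (if \<exists>t<n. e mod f = (j + 1 + t) mod f then 1 else 0)" for e
  show ?thesis
  proof (rule that[of b])
    show "periodic f b" by (auto simp: periodic_def b_def)
    show "b e = 0 \<or> b e = 1" for e by (simp add: b_def)
    show "b e \<le> g e" for e
      using nmin periodic_cong[OF assms(1)] assms(3)[of e] unfolding b_def by (smt (verit))
    show "b (j + 1) = 1" using npos by (auto simp: b_def intro!: exI[of _ 0])
    have "b j = 0"
    proof -
      have "\<not> (\<exists>t<n. j mod f = (j + 1 + t) mod f)"
      proof
        assume "\<exists>t<n. j mod f = (j + 1 + t) mod f"
        then obtain t where t: "t < n" "j mod f = (j + 1 + t) mod f" by blast
        then have "f dvd (j + 1 + t) - j" by (metis mod_eq_dvd_iff_nat le_add1 add.assoc)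
        then have "f dvd 1 + t" by simp
        then have "f \<le> 1 + t" by (rule dvd_imp_le) simp
        then show False using t nf by linarith
      qed
      then show ?thesis by (simp add: b_def)
    qed
    moreover have "b (j + n) = 1"
      using npos by (auto simp: b_def intro!: exI[of _ "n - 1"])
    moreover have "g (j + n) \<ge> 1" using nmin[of "n - 1"] npos by simp
    moreover have "g (j + n + 1) = 0" using n0 by (simp add: algebra_simps)
    moreover have "e mod f = (j + n) mod f" if b: "b e = 1" "b (e + 1) = 0" for e
    proof -
      obtain t where t: "t < n" "e mod f = (j + 1 + t) mod f"
        using b(1) unfolding b_def by (metis zero_neq_one)
      have "(e + 1) mod f = (j + 1 + (t + 1)) mod f"
        using t(2) by (metis mod_add_left_eq add.assoc)
      then have "\<not> t + 1 < n" using b(2) by (auto simp: b_def split: if_splits)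
      then have "t = n - 1" using t(1) by linarith
      then show ?thesis using t(2) npos by simp
    qed
    ultimately show "(\<forall>e. b e = 1) \<or>
     (\<exists>e0. b j = 0 \<and> b e0 = 1 \<and> g e0 \<ge> 1 \<and> g (e0 + 1) = 0 \<and>
        (\<forall>e. b e = 1 \<longrightarrow> b (e + 1) = 0 \<longrightarrow> e mod f = e0 mod f))" by blast
  qed
qed

text \<open>The highest differing digit decides, since the digits below position \<open>n\<close>
  together contribute less than \<open>p ^ n\<close>.\<close>

lemma leading_digit:
  fixes x y :: "nat \<Rightarrow> int" and p :: int
  assumes "\<And>i. 0 \<le> x i" "\<And>i. x i < p" "\<And>i. 0 \<le> y i" "\<And>i. y i < p"
    and "(\<Sum>i<K. x i * p ^ i) < (\<Sum>i<K. y i * p ^ i)"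
  shows "\<exists>i<K. x i < y i \<and> (\<forall>j. i < j \<longrightarrow> j < K \<longrightarrow> x j = y j)"
  using assms(5)
proof (induction K)
  case (Suc K)
  have p: "1 \<le> p" using assms(1,2)[of 0] by linarith
  have bound: "(\<Sum>i<n. z i * p ^ i) < p ^ n" if "\<And>i. z i < p" for z :: "nat \<Rightarrow> int" and n
  proof (induction n)
    case (Suc n)
    have "z n * p ^ n \<le> (p - 1) * p ^ n" using that[of n] p by (intro mult_right_mono) auto
    then show ?case using Suc by (simp add: algebra_simps)
  qed simp
  have nonneg: "0 \<le> (\<Sum>i<K. y i * p ^ i)" "0 \<le> (\<Sum>i<K. x i * p ^ i)"
    using assms p by (auto intro!: sum_nonneg)
  consider "x K = y K" | "x K < y K" | "y K + 1 \<le> x K" by linarith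
  then show ?case
  proof cases
    case 1
    then show ?thesis using Suc by (metis (no_types, lifting) less_Suc_eq sum.lessThan_Suc add_less_cancel_right)
  next
    case 2 then show ?thesis by (intro exI[of _ K]) auto
  next
    case 3
    then have "(y K + 1) * p ^ K \<le> x K * p ^ K" using p by (intro mult_right_mono) auto
    then have False using Suc.prems bound[of y K, OF assms(4)] nonneg by (simp add: algebra_simps)
    then show ?thesis ..
  qed
qed simp

text \<open>Complementary to the degree: on \<open>U_set p q d k\<close> the two add up to
  \<open>d * k\<close>, so minimising \<open>t_exponent\<close> means maximising this score.\<close>

definition tuple_score :: "nat list \<Rightarrow> nat" where
  "tuple_score m = (\<Sum>i<length m. i * m ! i)"

lemma sum_list_nth: "(\<Sum>x\<leftarrow>m. g x) = (\<Sum>i<length m. g (m ! i))"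
  by (simp add: sum_list_sum_nth atLeast0LessThan)

lemma sum_list_lessThan: "sum_list m = (\<Sum>i<length m. m ! i)"
  by (simp add: sum_list_sum_nth atLeast0LessThan)

text \<open>The term \<open>g i\<close> occurs in the partial sums with
  \<open>d - i \<le> s < d\<close>, that is, \<open>i\<close> times.\<close>

lemma sum_of_upper_sums:
  fixes g :: "nat \<Rightarrow> nat"
  shows "(\<Sum>s<d. \<Sum>r\<le>s. g (d - r)) = (\<Sum>i<Suc d. i * g i)"
proof -
  have "(\<Sum>s<d. \<Sum>r\<le>s. g (d - r)) = (\<Sum>s<d. \<Sum>r<d. if r \<le> s then g (d - r) else 0)"
    by (intro sum.cong refl sum.mono_neutral_cong_left) auto
  also have "\<dots> = (\<Sum>r<d. \<Sum>s<d. if r \<le> s then g (d - r) else 0)" by (rule sum.swap)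
  also have "\<dots> = (\<Sum>r<d. (d - r) * g (d - r))"
  proof (intro sum.cong refl)
    fix r assume "r \<in> {..<d}"
    have "(\<Sum>s<d. if r \<le> s then g (d - r) else 0) = (\<Sum>s\<in>{r..<d}. g (d - r))"
      by (intro sum.mono_neutral_cong_right) auto
    then show "(\<Sum>s<d. if r \<le> s then g (d - r) else 0) = (d - r) * g (d - r)" by simp
  qed
  also have "\<dots> = (\<Sum>i\<in>{1..d}. i * g i)"
    by (rule sum.reindex_bij_witness[of _ "\<lambda>i. d - i" "\<lambda>r. d - r"]) auto
  also have "\<dots> = (\<Sum>i<Suc d. i * g i)"
    by (intro sum.mono_neutral_left) auto
  finally show ?thesis .
qed

text \<open>The function \<open>min N\<close> is concave, and the new pair has the same sum and is
  at least as close together.\<close>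

lemma concave_min:
  fixes N :: int
  assumes "x + y = x' + y'" "min x y \<le> x'" "x' \<le> max x y"
  shows "min N x + min N y \<le> min N x' + min N y'"
  using assms by (auto simp: min_def max_def split: if_splits)

section \<open>Selections of digits\<close>

locale digit_classes =
  fixes p f K k :: nat
  assumes p_ge2: "2 \<le> p" and f_pos: "0 < f" and k_less: "k < p ^ K"
begin

text \<open>The digits at position \<open>i\<close> and above in the class of \<open>i\<close>
  modulo \<open>f\<close>. \<open>K\<close> summands suffice for vectors that vanish from
  \<open>K\<close> on.\<close>

definition tail :: "(nat \<Rightarrow> int) \<Rightarrow> nat \<Rightarrow> int" where
  "tail x i = (\<Sum>n<K. x (i + n * f))"

definition weight :: "(nat \<Rightarrow> int) \<Rightarrow> int" where
  "weight x = (\<Sum>i<K. x i * int p ^ i)"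

definition dig :: "nat \<Rightarrow> nat \<Rightarrow> int" where
  "dig n i = int (digit p n i)"

definition N :: "nat \<Rightarrow> int" where
  "N = tail (dig k)"

text \<open>The excess of \<open>p ^ i\<close> over the next lower power in the same class; this is
  the coefficient produced by summation by parts.\<close>

definition wt :: "nat \<Rightarrow> int" where
  "wt i = int p ^ i - (if i < f then 0 else int p ^ (i - f))"

text \<open>
  \<open>best v\<close> is the largest value of a selection of \<open>v e\<close> digits from each class \<open>e\<close>; it is attained by
  \<open>sat v\<close> below, which takes the highest positions of each class.
\<close>

definition best :: "(nat \<Rightarrow> int) \<Rightarrow> int" where
  "best v = (\<Sum>i<K. wt i * min (N i) (v i))"

lemma le_add_mult_f: "n \<le> i + n * f"
proof -
  have "n * 1 \<le> n * f" using f_pos by (intro mult_le_mono2) linarith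
  then show ?thesis by linarith
qed

lemma tail_step:
  assumes "\<And>i. K \<le> i \<Longrightarrow> x i = 0"
  shows "tail x i = x i + tail x (i + f)"
proof -
  have "tail x i = (\<Sum>n<Suc K. x (i + n * f))" using assms[OF le_add_mult_f] by (simp add: tail_def)
  also have "\<dots> = x i + (\<Sum>n<K. x (i + Suc n * f))"
    by (subst sum.lessThan_Suc_shift) simp
  also have "(\<Sum>n<K. x (i + Suc n * f)) = tail x (i + f)"
    by (simp add: tail_def algebra_simps)
  finally show ?thesis .
qed

lemma tail_beyond:
  assumes "\<And>i. K \<le> i \<Longrightarrow> x i = 0" "K \<le> i"
  shows "tail x i = 0"
  using assms by (simp add: tail_def)

lemma tail_mono: "(\<And>i. x i \<le> y i) \<Longrightarrow> tail x i \<le> tail y i"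
  by (simp add: tail_def sum_mono)

lemma tail_nonneg: "(\<And>i. 0 \<le> x i) \<Longrightarrow> 0 \<le> tail x i"
  by (simp add: tail_def sum_nonneg)

lemma wt_nonneg: "0 \<le> wt i"
  using p_ge2 by (auto simp: wt_def intro!: power_increasing)

text \<open>Summation by parts within the classes modulo \<open>f\<close>; it makes \<open>best\<close> visibly concave.\<close>

lemma weight_tail:
  assumes "\<And>i. K \<le> i \<Longrightarrow> x i = 0"
  shows "weight x = (\<Sum>i<K. wt i * tail x i)"
proof -
  have *: "(\<Sum>i<K. int p ^ i * tail x (i + f)) = (\<Sum>i<K. (if i < f then 0 else int p ^ (i - f)) * tail x i)"
  proof -
    have "(\<Sum>i<K. (if i < f then 0 else int p ^ (i - f)) * tail x i)
        = (\<Sum>i<K + f. (if i < f then 0 else int p ^ (i - f)) * tail x i)"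
      using tail_beyond[OF assms] by (intro sum.mono_neutral_left) auto
    also have "\<dots> = (\<Sum>i\<in>(\<lambda>i. i + f) ` {..<K}. int p ^ (i - f) * tail x i)"
    proof (rule sum.mono_neutral_cong_right)
      show "(\<lambda>i. i + f) ` {..<K} \<subseteq> {..<K + f}" by auto
      show "\<forall>i\<in>{..<K + f} - (\<lambda>i. i + f) ` {..<K}. (if i < f then 0 else int p ^ (i - f)) * tail x i = 0"
      proof
        fix i assume i: "i \<in> {..<K + f} - (\<lambda>i. i + f) ` {..<K}"
        have "i < f"
        proof (rule ccontr)
          assume "\<not> i < f"
          then have "i - f < K" "(i - f) + f = i" using i by auto
          then show False using i by (metis DiffD2 imageI lessThan_iff)
        qed
        then show "(if i < f then 0 else int p ^ (i - f)) * tail x i = 0" by simp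
      qed
    qed auto
    also have "\<dots> = (\<Sum>i<K. int p ^ i * tail x (i + f))"
      by (subst sum.reindex) (auto simp: inj_on_def)
    finally show ?thesis by simp
  qed
  have "weight x = (\<Sum>i<K. int p ^ i * tail x i - int p ^ i * tail x (i + f))"
    unfolding weight_def
  proof (intro sum.cong refl)
    fix i
    have "x i = tail x i - tail x (i + f)" using tail_step[of x i] assms by simp
    then show "x i * int p ^ i = int p ^ i * tail x i - int p ^ i * tail x (i + f)"
      by (simp only: right_diff_distrib[symmetric] mult.commute)
  qed
  also have "\<dots> = (\<Sum>i<K. wt i * tail x i)"
    unfolding sum_subtractf * wt_def by (simp add: sum_subtractf left_diff_distrib)
  finally show ?thesis .
qed

lemma dig_bounds: "0 \<le> dig n i" "dig n i \<le> int p - 1"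
proof -
  have "(n div p ^ i) mod p < p" using p_ge2 by (intro mod_less_divisor) simp
  then show "0 \<le> dig n i" "dig n i \<le> int p - 1" by (auto simp: dig_def digit_def)
qed

lemma dig_beyond:
  assumes "n < p ^ K" "K \<le> i"
  shows "dig n i = 0"
proof -
  have "p ^ K \<le> p ^ i" using p_ge2 assms(2) by (intro power_increasing) auto
  then have "n div p ^ i = 0" using assms(1) by (intro div_less) linarith
  then show ?thesis by (simp add: dig_def digit_def)
qed

lemmas dig_k_beyond = dig_beyond[OF k_less]

lemma N_step: "N i = dig k i + N (i + f)"
  unfolding N_def by (rule tail_step) (rule dig_k_beyond)

lemma N_beyond: "K \<le> i \<Longrightarrow> N i = 0"
  unfolding N_def by (rule tail_beyond) (rule dig_k_beyond)

lemma N_nonneg: "0 \<le> N i"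
  unfolding N_def by (rule tail_nonneg) (rule dig_bounds)

lemma N_step_le: "N (i + f) \<le> N i" "N i \<le> N (i + f) + (int p - 1)"
  using N_step[of i] dig_bounds[of k i] by linarith+

lemma N_antimono_mult: "N (i + n * f) \<le> N i"
proof (induction n)
  case (Suc n)
  have "N (i + Suc n * f) = N ((i + n * f) + f)" by (simp add: algebra_simps)
  then show ?case using Suc N_step_le(1)[of "i + n * f"] by linarith
qed simp

lemma N_antimono:
  assumes "i \<le> j" "i mod f = j mod f"
  shows "N j \<le> N i"
  using assms N_antimono_mult by (auto elim!: mod_eq_obtain_mult)

definition cap :: "nat \<Rightarrow> int" where
  "cap e = N (e mod f)"

lemma cap_periodic: "periodic f cap"
  by (simp add: periodic_def cap_def)

lemma N_le_cap: "N i \<le> cap i"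
  unfolding cap_def by (rule N_antimono) auto

text \<open>If the highest digits are preferred, \<open>min (N i) (v i)\<close> of them lie at
  position \<open>i\<close> or above; the difference isolates position \<open>i\<close>.\<close>

definition sat :: "(nat \<Rightarrow> int) \<Rightarrow> nat \<Rightarrow> int" where
  "sat v i = min (N i) (v i) - min (N (i + f)) (v i)"

lemma sat_nonneg: "0 \<le> sat v i"
  using N_step_le(1)[of i] by (simp add: sat_def)

lemma sat_le: "sat v i \<le> dig k i"
  using N_step[of i] dig_bounds(1)[of k i] by (auto simp: sat_def min_def)

lemma sat_beyond: "K \<le> i \<Longrightarrow> sat v i = 0"
  using sat_le[of v i] sat_nonneg[of v i] dig_k_beyond[of i] by linarith

lemma sat_mono: "v i \<le> v' i \<Longrightarrow> sat v i \<le> sat v' i"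
  using N_step_le(1)[of i] by (auto simp: sat_def min_def)

lemma tail_sat:
  assumes "periodic f v" "\<And>i. 0 \<le> v i"
  shows "tail (sat v) i = min (N i) (v i)"
proof -
  have "(\<Sum>n<m. sat v (i + n * f)) = min (N i) (v i) - min (N (i + m * f)) (v i)" for m
  proof (induction m)
    case (Suc m)
    have "v (i + m * f) = v i" using periodic_add_mult[OF assms(1)] .
    then show ?case using Suc by (simp add: sat_def algebra_simps)
  qed simp
  moreover note le_add_mult_f[of K i]
  ultimately show ?thesis using N_beyond assms(2)[of i] by (simp add: tail_def)
qed

lemma weight_sat:
  assumes "periodic f v" "\<And>i. 0 \<le> v i"
  shows "weight (sat v) = best v"
  using weight_tail[of "sat v"] sat_beyond tail_sat[OF assms] by (simp add: best_def)

text \<open>Both \<open>N i\<close> and \<open>v i\<close> bound the tails of \<open>x\<close>, and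
  summation by parts has nonnegative coefficients.\<close>

lemma weight_le_best:
  assumes "\<And>i. 0 \<le> x i" "\<And>i. x i \<le> dig k i" "\<And>i. tail x i \<le> v i"
  shows "weight x \<le> best v"
proof -
  have z: "x i = 0" if "K \<le> i" for i
    using assms(1)[of i] assms(2)[of i] dig_k_beyond[OF that] by linarith
  have "tail x i \<le> min (N i) (v i)" for i
    using assms(3) tail_mono[OF assms(2)] by (simp add: N_def)
  then show ?thesis
    using weight_tail[OF z] wt_nonneg by (auto simp: best_def intro!: sum_mono mult_left_mono)
qed

section \<open>Values of single digits within a class\<close>

definition part :: "nat \<Rightarrow> int \<Rightarrow> int" where
  "part e n = (\<Sum>i<K. if i mod f = e then wt i * min (N i) n else 0)"

text \<open>\<open>gain e n\<close> is the value of the digit of rank \<open>n\<close>, counted from \<open>0\<close>, in class \<open>e\<close> of \<open>k\<close>.\<close>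

definition gain :: "nat \<Rightarrow> int \<Rightarrow> int" where
  "gain e n = part e (n + 1) - part e n"

lemma best_parts:
  assumes "periodic f v"
  shows "best v = (\<Sum>e<f. part e (v e))"
proof -
  have "(\<Sum>e<f. part e (v e)) = (\<Sum>i<K. \<Sum>e<f. if i mod f = e then wt i * min (N i) (v e) else 0)"
    unfolding part_def by (rule sum.swap)
  also have "\<dots> = (\<Sum>i<K. wt i * min (N i) (v (i mod f)))"
    using f_pos by (intro sum.cong refl) (simp add: sum.delta)
  finally show ?thesis unfolding best_def periodic_mod[OF assms] by simp
qed

lemma part_mono: "m \<le> n \<Longrightarrow> part e m \<le> part e n"
  unfolding part_def using wt_nonneg by (intro sum_mono) (auto intro!: mult_left_mono)

lemma gain_nonneg: "0 \<le> gain e n"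
  using part_mono[of n "n + 1" e] by (simp add: gain_def)

lemma gain_eq_sum: "gain e n = (\<Sum>i<K. if i mod f = e \<and> n < N i then wt i else 0)"
  unfolding gain_def part_def sum_subtractf[symmetric]
proof (intro sum.cong refl)
  fix i
  have "min (N i) (n + 1) - min (N i) n = (if n < N i then 1 else 0)" by auto
  then have "wt i * min (N i) (n + 1) - wt i * min (N i) n = wt i * (if n < N i then 1 else 0)"
    by (simp only: right_diff_distrib[symmetric])
  then show "(if i mod f = e then wt i * min (N i) (n + 1) else 0) - (if i mod f = e then wt i * min (N i) n else 0)
      = (if i mod f = e \<and> n < N i then wt i else 0)" by auto
qed

lemma gain_antimono: "m \<le> n \<Longrightarrow> gain e n \<le> gain e m"
  unfolding gain_eq_sum using wt_nonneg by (intro sum_mono) auto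

lemma gain_zero:
  assumes "N e \<le> n" "e < f"
  shows "gain e n = 0"
proof -
  have "N i \<le> n" if "i mod f = e" for i
    using N_le_cap[of i] that assms by (simp add: cap_def)
  then show ?thesis unfolding gain_eq_sum by (intro sum.neutral) force
qed

text \<open>The digit of rank \<open>n\<close> sits at position \<open>i\<close>, as
  \<open>N (i + f)\<close> digits of its class lie higher. The tails of the unit vector at
  \<open>i\<close> are exactly the indicators in \<open>gain_eq_sum\<close>, so summation by parts
  returns its weight \<open>p ^ i\<close>.\<close>

lemma gain_eq:
  assumes "i < K" "i mod f = e" "N (i + f) \<le> n" "n < N i"
  shows "gain e n = int p ^ i"
proof -
  define x :: "nat \<Rightarrow> int" where "x j = (if j = i then 1 else 0)" for j
  have tx: "tail x j = (if j mod f = e \<and> n < N j then 1 else 0)" for j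
  proof (cases "j mod f = e \<and> j \<le> i")
    case True
    then obtain m where m: "i = j + m * f" using assms(2) mod_eq_obtain_mult[of j i f] by auto
    have "m \<le> i" using m le_add_mult_f[of m j] by simp
    then have "m < K" using assms(1) by simp
    have "tail x j = (\<Sum>n<K. if n = m then 1 else 0)"
      unfolding tail_def x_def m using f_pos by (intro sum.cong refl) auto
    also have "\<dots> = 1" using \<open>m < K\<close> by simp
    finally show ?thesis using True assms N_antimono[of j i] by force
  next
    case False
    have "tail x j = 0"
      unfolding tail_def
    proof (intro sum.neutral ballI)
      fix t
      have "j + t * f \<noteq> i" using False assms(2) by auto
      then show "x (j + t * f) = 0" by (simp add: x_def)
    qed
    moreover have "N j \<le> n" if je: "j mod f = e"
    proof -
      have "i < j" using False je by simp
      then obtain m where m: "j = i + m * f" using assms(2) je mod_eq_obtain_mult[of i j f] by (metis less_imp_le)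
      then have "m \<noteq> 0" using \<open>i < j\<close> by auto
      then have "i + f \<le> j" using m by (cases m) auto
      then have "N j \<le> N (i + f)" using je assms(2) by (intro N_antimono) auto
      then show ?thesis using assms(3) by linarith
    qed
    ultimately show ?thesis by force
  qed
  have "int p ^ i = weight x"
    unfolding weight_def x_def using assms(1) by (simp add: if_distrib[of "\<lambda>a. a * _"] sum.delta cong: if_cong)
  also have "\<dots> = (\<Sum>i<K. wt i * tail x i)"
    by (rule weight_tail) (use assms(1) in \<open>auto simp: x_def\<close>)
  also have "\<dots> = gain e n"
    unfolding gain_eq_sum tx by (intro sum.cong refl) auto
  finally show ?thesis by simp
qed

lemma gain_position:
  assumes "0 \<le> n" "n < N e" "e < f"
  obtains i where "i < K" "i mod f = e" "N (i + f) \<le> n" "n < N i"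
proof -
  define m where "m = (LEAST m. N (e + m * f) \<le> n)"
  note le_add_mult_f[of K e]
  then have ex: "N (e + K * f) \<le> n" using N_beyond assms(1) by simp
  have m: "N (e + m * f) \<le> n" unfolding m_def by (rule LeastI) (rule ex)
  have "m \<noteq> 0" using m assms(2) by (cases m) auto
  then obtain l where l: "m = Suc l" by (cases m) auto
  have "n < N (e + l * f)" using not_less_Least[of l "\<lambda>m. N (e + m * f) \<le> n"] l by (simp add: m_def[symmetric])
  moreover have "N (e + l * f + f) \<le> n" using m l by (simp add: algebra_simps)
  moreover have "e + l * f < K"
    using N_beyond[of "e + l * f"] \<open>n < N (e + l * f)\<close> assms(1) by (metis not_le)
  moreover have "(e + l * f) mod f = e" using assms(3) by simp
  ultimately show ?thesis using that by blast
qed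

text \<open>A position holds at most \<open>p - 1\<close> digits, so the digit \<open>p - 1\<close>
  ranks further on lies at a lower position and is worth at most half as much.\<close>

lemma gain_halves:
  assumes "0 \<le> n" "e < f"
  shows "2 * gain e (n + (int p - 1)) \<le> gain e n"
proof (cases "n + (int p - 1) < N e")
  case True
  then obtain i where i: "i < K" "i mod f = e" "N (i + f) \<le> n + (int p - 1)" "n + (int p - 1) < N i"
    using gain_position[of "n + (int p - 1)" e] assms p_ge2 by auto
  have "n < N (i + f)" using N_step_le(2)[of i] i(4) by linarith
  then have "i + f < K" using N_beyond[of "i + f"] assms(1) by (metis not_le order.strict_trans1 less_irrefl)
  obtain j where j: "j < K" "j mod f = e" "N (j + f) \<le> n" "n < N j"
    using gain_position[of n e] assms True p_ge2 by auto
  have "i < j"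
  proof (rule ccontr)
    assume "\<not> i < j"
    then have "N (i + f) \<le> N (j + f)" using i(2) j(2) by (intro N_antimono) auto
    then show False using \<open>n < N (i + f)\<close> j(3) by linarith
  qed
  then have "int p ^ Suc i \<le> int p ^ j" using p_ge2 by (intro power_increasing) auto
  moreover have "2 * int p ^ i \<le> int p * int p ^ i" using p_ge2 by (intro mult_right_mono) auto
  ultimately show ?thesis using gain_eq[OF i] gain_eq[OF j] by simp
next
  case False
  then show ?thesis using gain_zero[of e] gain_nonneg assms by simp
qed

lemma gain_halves_iterate:
  assumes "0 \<le> n" "e < f"
  shows "2 ^ s * gain e (n + int s * (int p - 1)) \<le> gain e n"
proof (induction s)
  case (Suc s)
  have "0 \<le> n + int s * (int p - 1)" using assms(1) p_ge2 by simp
  from gain_halves[OF this assms(2)]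
  have "2 * gain e (n + int (Suc s) * (int p - 1)) \<le> gain e (n + int s * (int p - 1))"
    by (simp add: algebra_simps)
  then have "2 ^ s * (2 * gain e (n + int (Suc s) * (int p - 1))) \<le> 2 ^ s * gain e (n + int s * (int p - 1))"
    by (intro mult_left_mono) auto
  then show ?case using Suc by (simp only: power_Suc mult.assoc mult.left_commute[of 2])
qed simp

text \<open>Compare the saturated selections at the highest position \<open>i\<close> where they
  differ. The next digit available to \<open>v\<close> in the class of \<open>i\<close> lies at or
  above \<open>i\<close>. In a class where \<open>v'\<close> takes fewer digits the two differ only
  below \<open>i\<close>, so the last digit of \<open>v\<close> there is worth at most half of
  \<open>p ^ i\<close>.\<close>

lemma best_less_witness:
  assumes "periodic f v" "periodic f v'" "\<And>i. 0 \<le> v i" "\<And>i. 0 \<le> v' i" "best v < best v'"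
    and "\<And>i. v i \<le> cap i"
  obtains i where "i < K" "v i < v' i" "int p ^ i \<le> gain (i mod f) (v i)"
    "\<And>e. e < f \<Longrightarrow> v' e < v e \<Longrightarrow> 2 * gain e (v e - 1) \<le> int p ^ i"
proof -
  have "\<exists>i<K. sat v i < sat v' i \<and> (\<forall>j. i < j \<longrightarrow> j < K \<longrightarrow> sat v j = sat v' j)"
  proof (rule leading_digit)
    show "(\<Sum>i<K. sat v i * int p ^ i) < (\<Sum>i<K. sat v' i * int p ^ i)"
      using weight_sat[OF assms(1,3)] weight_sat[OF assms(2,4)] assms(5) by (simp add: weight_def)
    show "sat v i < int p" "sat v' i < int p" for i
      using sat_le[of v i] sat_le[of v' i] dig_bounds(2)[of k i] by linarith+
  qed (rule sat_nonneg)+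
  then obtain i where i: "i < K" "sat v i < sat v' i" "\<And>j. i < j \<Longrightarrow> j < K \<Longrightarrow> sat v j = sat v' j" by blast
  show ?thesis
  proof (rule that[of i])
    show "i < K" by (rule i)
    show lt: "v i < v' i" using i(2) sat_mono[of v' i v] by force
    have "v i < N i" using i(2) lt by (auto simp: sat_def min_def split: if_splits)
    show "int p ^ i \<le> gain (i mod f) (v i)"
    proof -
      have "v (i mod f) = v i" using periodic_mod[OF assms(1)] .
      obtain j where j: "j < K" "j mod f = i mod f" "N (j + f) \<le> v i" "v i < N j"
        using gain_position[of "v i" "i mod f"] assms(3)[of i] \<open>v i < N i\<close> N_le_cap[of i] f_pos
        unfolding cap_def by (metis mod_less_divisor order.strict_trans2)
      have "i \<le> j"
      proof (rule ccontr)
        assume "\<not> i \<le> j"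
        then obtain m where m: "i = j + m * f"
          using j(2) mod_eq_obtain_mult[of j i f] by auto
        then have "m \<noteq> 0" using \<open>\<not> i \<le> j\<close> by auto
        then have "j + f \<le> i" using m by (cases m) auto
        then have "N i \<le> N (j + f)" using j(2) by (intro N_antimono) auto
        then show False using \<open>v i < N i\<close> j(3) by linarith
      qed
      then show ?thesis using gain_eq[OF j] p_ge2 by (simp add: power_increasing)
    qed
    fix e assume e: "e < f" "v' e < v e"
    have "0 \<le> v e - 1" using assms(4)[of e] e(2) by linarith
    moreover have "v e - 1 < N e" using assms(6)[of e] e(1) by (simp add: cap_def)
    ultimately obtain j where j: "j < K" "j mod f = e" "N (j + f) \<le> v e - 1" "v e - 1 < N j"
      using gain_position[of "v e - 1" e] e(1) by blast
    have ve: "v j = v e" "v' j = v' e"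
      using periodic_mod[OF assms(1), of j] periodic_mod[OF assms(2), of j] j(2) by auto
    have "sat v j \<noteq> sat v' j"
      using j(3,4) e(2) ve by (auto simp: sat_def min_def split: if_splits)
    moreover have "j \<noteq> i" using e(2) lt ve by auto
    ultimately have "j < i" using i(3)[of j] j(1) by (meson linorder_neqE_nat)
    then have "int p ^ Suc j \<le> int p ^ i" using p_ge2 by (intro power_increasing) auto
    moreover have "2 * int p ^ j \<le> int p * int p ^ j" using p_ge2 by (intro mult_right_mono) auto
    ultimately show "2 * gain e (v e - 1) \<le> int p ^ i" using gain_eq[OF j] by simp
  qed
qed

section \<open>Chains of selections\<close>

definition cnt :: "(nat \<Rightarrow> int) \<Rightarrow> nat \<Rightarrow> int" where
  "cnt c e = int p * c (e + 1) - c e"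

definition feasible :: "(nat \<Rightarrow> int) \<Rightarrow> bool" where
  "feasible c \<longleftrightarrow> periodic f c \<and> (\<forall>e. 0 \<le> cnt c e \<and> cnt c e \<le> cap e)"

text \<open>
  \<open>A s\<close> stands for the coordinates of \<open>m\<^sub>d + \<dots> + m\<^bsub>d-s\<^esub>\<close>. That each \<open>m\<^sub>i\<close> is a selection is relaxed to
  the gap condition.
\<close>

definition chain :: "nat \<Rightarrow> (nat \<Rightarrow> nat \<Rightarrow> int) \<Rightarrow> bool" where
  "chain d A \<longleftrightarrow> (\<forall>s<d. feasible (A s)) \<and> (\<forall>e. 0 < d \<longrightarrow> 1 \<le> A 0 e) \<and>
     (\<forall>s e. Suc s < d \<longrightarrow> A s e + 1 \<le> A (Suc s) e)"

definition score :: "nat \<Rightarrow> (nat \<Rightarrow> nat \<Rightarrow> int) \<Rightarrow> int" where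
  "score d A = (\<Sum>s<d. best (cnt (A s)))"

lemma cnt_periodic: "periodic f c \<Longrightarrow> periodic f (cnt c)"
  unfolding periodic_def cnt_def by (metis add.commute add.left_commute)

lemma feasibleD:
  assumes "feasible c"
  shows "periodic f c" "0 \<le> cnt c e" "cnt c e \<le> cap e"
  using assms by (auto simp: feasible_def)

lemma p_mult_mono: "(a::int) \<le> b \<Longrightarrow> int p * a \<le> int p * b"
  by (rule mult_left_mono) auto

lemma best_exchange:
  assumes "\<And>e. x' e + y' e = x e + y e" "\<And>e. min (x e) (y e) \<le> x' e" "\<And>e. x' e \<le> max (x e) (y e)"
  shows "best x + best y \<le> best x' + best y'"
proof -
  have "wt i * min (N i) (x i) + wt i * min (N i) (y i) \<le> wt i * min (N i) (x' i) + wt i * min (N i) (y' i)" for i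
  proof -
    have "min (N i) (x i) + min (N i) (y i) \<le> min (N i) (x' i) + min (N i) (y' i)"
      using assms by (intro concave_min) (auto simp: assms(1))
    then show ?thesis
      unfolding distrib_left[symmetric] using wt_nonneg by (rule mult_left_mono)
  qed
  then show ?thesis unfolding best_def sum.distrib[symmetric] by (rule sum_mono)
qed

text \<open>Multiplication by \<open>p\<close> commutes with max and min, so each new count is a
  difference of two maxima or of two minima and lies between the old counts. Hence feasible vectors
  form a lattice, and \<open>best_exchange\<close> makes the best value supermodular.\<close>

lemma cnt_max_min:
  fixes a b :: "nat \<Rightarrow> int"
  defines "l \<equiv> \<lambda>e. min (a e) (b e)" and "m \<equiv> \<lambda>e. max (a e) (b e)"
  shows "cnt m e + cnt l e = cnt a e + cnt b e"
    "min (cnt a e) (cnt b e) \<le> cnt m e" "cnt m e \<le> max (cnt a e) (cnt b e)"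
    "min (cnt a e) (cnt b e) \<le> cnt l e" "cnt l e \<le> max (cnt a e) (cnt b e)"
proof -
  have pm: "int p * m (e + 1) = max (int p * a (e + 1)) (int p * b (e + 1))"
    "int p * l (e + 1) = min (int p * a (e + 1)) (int p * b (e + 1))"
    by (simp_all add: m_def l_def max_mult_distrib_left min_mult_distrib_left)
  show "cnt m e + cnt l e = cnt a e + cnt b e"
    "min (cnt a e) (cnt b e) \<le> cnt m e" "cnt m e \<le> max (cnt a e) (cnt b e)"
    "min (cnt a e) (cnt b e) \<le> cnt l e" "cnt l e \<le> max (cnt a e) (cnt b e)"
    unfolding cnt_def pm unfolding l_def m_def by linarith+
qed

lemma feasible_max_min:
  assumes "feasible a" "feasible b"
  shows "feasible (\<lambda>e. max (a e) (b e))" "feasible (\<lambda>e. min (a e) (b e))"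
proof -
  have "periodic f (\<lambda>e. max (a e) (b e))" "periodic f (\<lambda>e. min (a e) (b e))"
    using feasibleD(1)[OF assms(1)] feasibleD(1)[OF assms(2)] by (simp_all add: periodic_def)
  moreover have "0 \<le> cnt (\<lambda>e. max (a e) (b e)) e \<and> cnt (\<lambda>e. max (a e) (b e)) e \<le> cap e"
    "0 \<le> cnt (\<lambda>e. min (a e) (b e)) e \<and> cnt (\<lambda>e. min (a e) (b e)) e \<le> cap e" for e
    using cnt_max_min(2-5)[where a = a and b = b and e = e] feasibleD(2,3)[OF assms(1), of e] feasibleD(2,3)[OF assms(2), of e]
    by linarith+
  ultimately show "feasible (\<lambda>e. max (a e) (b e))" "feasible (\<lambda>e. min (a e) (b e))"
    unfolding feasible_def by blast+
qed

lemma best_max_min: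
  "best (cnt a) + best (cnt b) \<le> best (cnt (\<lambda>e. max (a e) (b e))) + best (cnt (\<lambda>e. min (a e) (b e)))"
  by (rule best_exchange) (rule cnt_max_min)+

lemma chainD:
  assumes "chain d A"
  shows "s < d \<Longrightarrow> feasible (A s)" "0 < d \<Longrightarrow> 1 \<le> A 0 e" "Suc s < d \<Longrightarrow> A s e + 1 \<le> A (Suc s) e"
  using assms by (auto simp: chain_def)

lemma chain_gap:
  assumes "chain d A" "s + t < d"
  shows "A s e + int t \<le> A (s + t) e"
  using assms(2)
proof (induction t)
  case (Suc t)
  then show ?case using chainD(3)[OF assms(1), of "s + t" e] by simp
qed simp

lemma chain_ge_one:
  assumes "chain d A" "s < d"
  shows "1 \<le> A s e"
  using chain_gap[OF assms(1), of 0 s e] chainD(2)[OF assms(1), of e] assms(2) by simp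

lemma chain_replace_bottom:
  assumes "chain d A" "0 < d" "feasible c" "\<And>e. 1 \<le> c e" "\<And>e. c e \<le> A 0 e"
  shows "chain d (A(0 := c))"
  unfolding chain_def
proof (intro conjI allI impI)
  fix s assume "s < d" then show "feasible ((A(0 := c)) s)" using assms by (auto dest: chainD)
next
  fix e show "1 \<le> (A(0 := c)) 0 e" using assms by simp
next
  fix s e assume "Suc s < d"
  then show "(A(0 := c)) s e + 1 \<le> (A(0 := c)) (Suc s) e"
    using chainD(3)[OF assms(1), of s e] assms(5)[of e] by (cases "s = 0") auto
qed

lemma score_update:
  assumes "s < d"
  shows "score d (A(s := c)) = score d A - best (cnt (A s)) + best (cnt c)"
proof -
  have "score d (A(s := c)) = (\<Sum>t\<in>{..<d} - {s}. best (cnt (A t))) + best (cnt c)"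
    unfolding score_def using assms by (subst sum.remove[of _ s]) auto
  moreover have "score d A = (\<Sum>t\<in>{..<d} - {s}. best (cnt (A t))) + best (cnt (A s))"
    unfolding score_def using assms by (subst sum.remove[of _ s]) auto
  ultimately show ?thesis by simp
qed

text \<open>
  The two selections exchange the digits of the classes in which they are nested the wrong way;
  the exchange is admissible because \<open>g\<close> is the largest vector below the difference of the
  coordinates that itself belongs to a selection.
\<close>

lemma nest_above:
  assumes "feasible c" "feasible c'" "\<And>e. c e + 1 \<le> c' e"
  obtains g where "periodic f g" "\<And>e. 1 \<le> g e" "\<And>e. c e + g e \<le> c' e" "\<And>e. 0 \<le> cnt g e"
    "feasible (\<lambda>e. c e + g e)" "feasible (\<lambda>e. c' e - g e)"
    "best (cnt c) + best (cnt c') \<le> best (cnt (\<lambda>e. c e + g e)) + best (cnt (\<lambda>e. c' e - g e))"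
proof -
  note per = feasibleD(1)[OF assms(1)] feasibleD(1)[OF assms(2)]
  have prem: "periodic f (\<lambda>e. c e - c' e)" "periodic f (\<lambda>_. - 1)" "periodic f (\<lambda>_. 0)" "0 \<le> int p"
    "\<And>e. c e - c' e \<le> - 1" "\<And>e. int p * (- 1) - 0 \<le> - 1"
    using per p_ge2 assms(3) by (auto simp: periodic_def algebra_simps)
  \<comment> \<open>Closure with bound \<open>0\<close>, negated: \<open>- y\<close> is the largest
    vector below \<open>c' - c\<close> with nonnegative counts. It is at least \<open>1\<close>
    because the constant \<open>1\<close> competes.\<close>
  obtain y where y: "least_closed f (int p) (\<lambda>_. 0) (\<lambda>e. c e - c' e) y"
    using ex_least_closed[OF prem] by blast
  define g where "g e = - y e" for e
  have g1: "1 \<le> g e" for e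
  proof -
    have "y e \<le> - 1"
      by (rule least_closed_le[OF y prem(2,5,6)])
    then show ?thesis by (simp add: g_def)
  qed
  have gle: "c e + g e \<le> c' e" for e using least_closedD(2)[OF y, of e] by (simp add: g_def)
  have cg: "0 \<le> cnt g e" for e using least_closedD(3)[OF y, of e] by (simp add: g_def cnt_def)
  have tight: "g e = c' e - c e \<or> cnt g e = 0" for e using least_closedD(4)[OF y, of e] by (auto simp: g_def cnt_def)
  \<comment> \<open>Where \<open>g\<close> equals \<open>c' - c\<close>, its count is at most
    \<open>cnt c' - cnt c\<close>; elsewhere it is zero. Thus both new counts lie between the old
    ones.\<close>
  have gbound: "cnt g e = 0 \<or> (cnt g e \<le> cnt c' e - cnt c e)" for e
    using tight[of e] p_mult_mono[OF gle[of "e + 1"]] by (auto simp: cnt_def algebra_simps)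
  have perg: "periodic f g" using least_closedD(1)[OF y] by (simp add: periodic_def g_def)
  have plus: "cnt (\<lambda>e. c e + g e) e = cnt c e + cnt g e" for e by (simp add: cnt_def algebra_simps)
  have minus: "cnt (\<lambda>e. c' e - g e) e = cnt c' e - cnt g e" for e by (simp add: cnt_def algebra_simps)
  have perg': "periodic f (\<lambda>e. c e + g e)" "periodic f (\<lambda>e. c' e - g e)"
    using per perg by (simp_all add: periodic_def)
  have bnd: "0 \<le> cnt c e + cnt g e \<and> cnt c e + cnt g e \<le> cap e"
    "0 \<le> cnt c' e - cnt g e \<and> cnt c' e - cnt g e \<le> cap e" for e
    using gbound[of e] cg[of e] feasibleD(2,3)[OF assms(1), of e] feasibleD(2,3)[OF assms(2), of e]
    by linarith+
  have "feasible (\<lambda>e. c e + g e)" "feasible (\<lambda>e. c' e - g e)"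
    unfolding feasible_def plus minus
    using perg' bnd by blast+
  moreover have "best (cnt c) + best (cnt c') \<le> best (cnt (\<lambda>e. c e + g e)) + best (cnt (\<lambda>e. c' e - g e))"
  proof (rule best_exchange)
    fix e
    show "cnt (\<lambda>e. c e + g e) e + cnt (\<lambda>e. c' e - g e) e = cnt c e + cnt c' e" by (simp add: plus minus)
    show "min (cnt c e) (cnt c' e) \<le> cnt (\<lambda>e. c e + g e) e" "cnt (\<lambda>e. c e + g e) e \<le> max (cnt c e) (cnt c' e)"
      unfolding plus using gbound[of e] cg[of e] by auto
  qed
  ultimately show ?thesis using that[OF perg g1 gle cg] by blast
qed

lemma best_le: "best v \<le> weight (dig k)"
proof -
  have "weight (dig k) = (\<Sum>i<K. wt i * N i)"
    using weight_tail[of "dig k"] dig_k_beyond by (simp add: N_def)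
  then show ?thesis unfolding best_def using wt_nonneg by (auto intro!: sum_mono mult_left_mono)
qed

lemma best_nonneg: "(\<And>i. 0 \<le> v i) \<Longrightarrow> 0 \<le> best v"
  unfolding best_def using wt_nonneg N_nonneg by (auto intro!: sum_nonneg)

text \<open>Among the chains of maximal score choose one with least coordinate sum. If a
  neighbouring pair were wrongly nested, lowering its upper member as in \<open>nest_above\<close>
  would keep the score and reduce the sum.\<close>

lemma optimal_nested_chain:
  assumes "chain d C"
  obtains A where "chain d A" "\<And>B. chain d B \<Longrightarrow> score d B \<le> score d A"
    "\<And>s e. Suc s < d \<Longrightarrow> cnt (A s) e \<le> cnt (A (Suc s)) e"
proof -
  have nonneg: "0 \<le> score d B" if "chain d B" for B
    unfolding score_def using that by (intro sum_nonneg best_nonneg) (auto dest: chainD feasibleD)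
  have bound: "nat (score d B) < nat (int d * weight (dig k)) + 1" for B
  proof -
    have "score d B \<le> (\<Sum>s<d. weight (dig k))" unfolding score_def by (intro sum_mono best_le)
    then show ?thesis by simp
  qed
  obtain A0 where A0: "chain d A0" "\<And>B. chain d B \<Longrightarrow> nat (score d B) \<le> nat (score d A0)"
    using ex_has_greatest_nat[of "chain d" C "\<lambda>B. nat (score d B)"] assms bound by (metis less_imp_le)
  define P where "P A \<longleftrightarrow> chain d A \<and> score d A = score d A0" for A
  define size where "size A = nat (\<Sum>s<d. \<Sum>e<f. A s e)" for A :: "nat \<Rightarrow> nat \<Rightarrow> int"
  obtain A where A: "P A" "\<And>B. P B \<Longrightarrow> size A \<le> size B"
    using ex_has_least_nat[of P A0 size] A0(1) by (auto simp: P_def)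
  have ch: "chain d A" using A(1) by (simp add: P_def)
  have opt: "score d B \<le> score d A" if "chain d B" for B
    using A0(2)[OF that] nonneg[OF that] nonneg[OF ch] A(1) by (simp add: P_def)
  have "cnt (A s) e \<le> cnt (A (Suc s)) e" if s: "Suc s < d" for s e
  proof -
    define c where "c = A s"
    define c' where "c' = A (Suc s)"
    have feas: "feasible c" "feasible c'" using chainD(1)[OF ch] s by (auto simp: c_def c'_def)
    have gap: "c e + 1 \<le> c' e" for e using chainD(3)[OF ch s] by (simp add: c_def c'_def)
    obtain g where g: "periodic f g" "\<And>e. 1 \<le> g e" "\<And>e. c e + g e \<le> c' e" "\<And>e. 0 \<le> cnt g e"
      "feasible (\<lambda>e. c e + g e)" "feasible (\<lambda>e. c' e - g e)"
      "best (cnt c) + best (cnt c') \<le> best (cnt (\<lambda>e. c e + g e)) + best (cnt (\<lambda>e. c' e - g e))"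
      using nest_above[OF feas gap] by blast
    \<comment> \<open>One half of the exchange at a time: \<open>A1\<close> lowers the upper
      selection, \<open>A2\<close> raises the lower one. As \<open>A2\<close> cannot beat
      \<open>A\<close>, the other half loses nothing and \<open>A1\<close> is optimal; minimal size
      then gives \<open>c + g = c'\<close>.\<close>
    define A1 where "A1 = A(Suc s := (\<lambda>e. c e + g e))"
    define A2 where "A2 = A(s := (\<lambda>e. c' e - g e))"
    have ch1: "chain d A1"
      unfolding chain_def
    proof (intro conjI allI impI)
      fix t assume "t < d" then show "feasible (A1 t)" using chainD(1)[OF ch] g(5) by (simp add: A1_def)
    next
      fix e assume "0 < d" then show "1 \<le> A1 0 e" using chainD(2)[OF ch] by (simp add: A1_def)
    next
      fix t e assume t: "Suc t < d"
      then show "A1 t e + 1 \<le> A1 (Suc t) e"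
        using chainD(3)[OF ch t, of e] g(2)[of e] g(3)[of e]
        by (auto simp: A1_def c_def c'_def)
    qed
    have ch2: "chain d A2"
      unfolding chain_def
    proof (intro conjI allI impI)
      fix t assume "t < d" then show "feasible (A2 t)" using chainD(1)[OF ch] g(6) by (simp add: A2_def)
    next
      fix e assume "0 < d"
      then show "1 \<le> A2 0 e" using chainD(2)[OF ch, of e] g(3)[of e] by (auto simp: A2_def c_def)
    next
      fix t e assume t: "Suc t < d"
      have "c e \<le> c' e - g e" using g(3)[of e] by simp
      then show "A2 t e + 1 \<le> A2 (Suc t) e"
        using chainD(3)[OF ch t, of e] g(2)[of e]
        by (auto simp: A2_def c_def c'_def)
    qed
    have "score d A2 \<le> score d A" using opt ch2 by blast
    then have "best (cnt (\<lambda>e. c' e - g e)) \<le> best (cnt c)"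
      using score_update[of s d A] s by (simp add: A2_def c_def)
    then have "best (cnt c') \<le> best (cnt (\<lambda>e. c e + g e))" using g(7) by linarith
    then have "score d A \<le> score d A1"
      using score_update[of "Suc s" d A] s by (simp add: A1_def c'_def)
    then have "P A1" using opt[OF ch1] ch1 A(1) by (simp add: P_def)
    then have "size A \<le> size A1" by (rule A(2))
    moreover have pos: "0 \<le> (\<Sum>s<d. \<Sum>e<f. B s e)" if "chain d B" for B
      using chain_ge_one[OF that] by (intro sum_nonneg) (meson lessThan_iff order_trans zero_le_one)
    ultimately have "(\<Sum>s<d. \<Sum>e<f. A s e) \<le> (\<Sum>s<d. \<Sum>e<f. A1 s e)"
      using pos[OF ch] pos[OF ch1] by (simp add: size_def)
    moreover have "(\<Sum>s<d. \<Sum>e<f. A s e) = (\<Sum>t\<in>{..<d} - {Suc s}. \<Sum>e<f. A t e) + (\<Sum>e<f. c' e)"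
      using s by (subst sum.remove[of _ "Suc s"]) (auto simp: c'_def)
    moreover have "(\<Sum>s<d. \<Sum>e<f. A1 s e) = (\<Sum>t\<in>{..<d} - {Suc s}. \<Sum>e<f. A t e) + (\<Sum>e<f. c e + g e)"
      using s by (subst sum.remove[of _ "Suc s"]) (auto simp: A1_def)
    ultimately have le: "(\<Sum>e<f. c' e) \<le> (\<Sum>e<f. c e + g e)" by linarith
    have eq: "c e + g e = c' e" if "e < f" for e
    proof (rule ccontr)
      assume "c e + g e \<noteq> c' e"
      then have "c e + g e < c' e" using g(3)[of e] by simp
      then have "(\<Sum>e<f. c e + g e) < (\<Sum>e<f. c' e)"
        using that g(3) by (intro sum_strict_mono_ex1) auto
      then show False using le by simp
    qed
    have eq': "c' e = c e + g e" for e
    proof -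
      have "e mod f < f" using f_pos by simp
      then show ?thesis
        using eq[of "e mod f"] periodic_mod[OF feasibleD(1)[OF feas(1)], of e]
          periodic_mod[OF feasibleD(1)[OF feas(2)], of e] periodic_mod[OF g(1), of e] by simp
    qed
    have "cnt c' e = cnt c e + cnt g e" by (simp add: cnt_def eq' algebra_simps)
    then show ?thesis using g(4)[of e] by (simp add: c_def c'_def)
  qed
  then show ?thesis using that ch opt by blast
qed

text \<open>The bottom is raised only by the indicator \<open>b\<close> of a run of
  \<open>c - A 0\<close>, and level \<open>s\<close> is replaced by the least vector above both
  \<open>A s\<close> and \<open>A 0 + s + b\<close> whose counts respect \<open>cap\<close>. The
  assumption \<open>room\<close> makes these closures exist. Gains of the bottom are then weighed
  against losses class by class, summed over all levels.\<close>

lemma improve_bottom: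
  assumes A: "chain d A" and C: "chain d C" and d: "0 < d"
    and ge: "\<And>e. A 0 e \<le> c e" and feas_c: "feasible c"
    and room: "\<And>e. c e + int (d - 1) \<le> max (A (d - 1) e) (C (d - 1) e)"
    and less: "best (cnt (A 0)) < best (cnt c)"
  obtains B where "chain d B" "score d A < score d B"
proof -
  have feas: "feasible (A s)" if "s < d" for s using chainD(1)[OF A that] .
  have feas0: "feasible (A 0)" using feas d by simp
  have perA: "periodic f (A s)" if "s < d" for s using feasibleD(1)[OF feas[OF that]] .
  have perc: "periodic f c" using feasibleD(1)[OF feas_c] .
  define n0 where "n0 = cnt (A 0)"
  have n0: "0 \<le> n0 e" "n0 e \<le> cap e" for e using feasibleD(2,3)[OF feas0] by (simp_all add: n0_def)
  have per_n0: "periodic f n0" unfolding n0_def by (rule cnt_periodic[OF perA[OF d]])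
  \<comment> \<open>Position \<open>j\<close> decides the comparison of the two bottoms. In any
    class where \<open>c\<close> has fewer digits, the last digit of \<open>A 0\<close> is worth at
    most half of \<open>p ^ j\<close>.\<close>
  obtain j where j: "j < K" "n0 j < cnt c j" "int p ^ j \<le> gain (j mod f) (n0 j)"
    "\<And>e. e < f \<Longrightarrow> cnt c e < n0 e \<Longrightarrow> 2 * gain e (n0 e - 1) \<le> int p ^ j"
    using best_less_witness[OF per_n0 cnt_periodic[OF perc] n0(1) feasibleD(2)[OF feas_c] _ n0(2)]
      less by (auto simp: n0_def)
  define g where "g e = c e - A 0 e" for e
  have perg: "periodic f g" using perc perA[OF d] by (simp add: periodic_def g_def)
  have g0: "0 \<le> g e" for e using ge[of e] by (simp add: g_def)
  have cnt_c: "cnt c e = n0 e + int p * g (e + 1) - g e" for e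
    by (simp add: cnt_def n0_def g_def algebra_simps)
  have "g (j + 1) \<noteq> 0" using cnt_c[of j] j(2) g0[of j] by auto
  then have g1: "1 \<le> g (j + 1)" using g0[of "j + 1"] by linarith
  obtain b where b: "periodic f b" "\<And>e. b e = 0 \<or> b e = 1" "\<And>e. b e \<le> g e" "b (j + 1) = 1"
    "(\<forall>e. b e = 1) \<or>
     (\<exists>e0. b j = 0 \<and> b e0 = 1 \<and> g e0 \<ge> 1 \<and> g (e0 + 1) = 0 \<and>
        (\<forall>e. b e = 1 \<longrightarrow> b (e + 1) = 0 \<longrightarrow> e mod f = e0 mod f))"
    using ex_run_indicator[OF perg f_pos g0 g1] by blast
  define x where "x s e = max (A s e) (A 0 e + int s + b e)" for s e
  have "\<exists>y. least_closed f (int p) cap (x s) y" if s: "s < d" for s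
  proof (rule ex_least_closed)
    \<comment> \<open>The join of the two top vectors is feasible and lies above every
      \<open>x s\<close>, so it bounds all closures.\<close>
    define U where "U e = max (A (d - 1) e) (C (d - 1) e)" for e
    show "periodic f (x s)" using perA[OF s] perA[OF d] b(1) by (simp add: periodic_def x_def)
    have feasU: "feasible U"
      unfolding U_def using feas chainD(1)[OF C] d by (intro feasible_max_min) auto
    show "periodic f U" using feasibleD(1)[OF feasU] .
    show "periodic f cap" by (rule cap_periodic)
    show "0 \<le> int p" by simp
    show "x s e \<le> U e" for e
    proof -
      have "A s e \<le> A (d - 1) e" using chain_gap[OF A, of s "d - 1 - s" e] s by simp
      moreover have "A 0 e + int s + b e \<le> c e + int (d - 1)"
        using b(3)[of e] s by (simp add: g_def)
      ultimately show ?thesis using room[of e] by (simp add: x_def U_def)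
    qed
    show "int p * U (e + 1) - cap e \<le> U e" for e
      using feasibleD(3)[OF feasU, of e] by (simp add: cnt_def)
  qed
  then have "\<forall>s\<in>{..<d}. \<exists>y. least_closed f (int p) cap (x s) y" by blast
  from bchoice[OF this] obtain B where B: "\<And>s. s < d \<Longrightarrow> least_closed f (int p) cap (x s) (B s)" by auto
  have BA: "A s e \<le> B s e" if "s < d" for s e
    using least_closedD(2)[OF B[OF that], of e] by (simp add: x_def)
  have Bb: "A 0 e + int s + b e \<le> B s e" if "s < d" for s e
    using least_closedD(2)[OF B[OF that], of e] by (simp add: x_def)
  have cap_B: "cnt (B s) e \<le> cap e" if "s < d" for s e
    using least_closedD(3)[OF B[OF that], of e] by (simp add: cnt_def)
  have capA: "cnt (A s) e \<le> cap e" "0 \<le> cnt (A s) e" if "s < d" for s e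
    using feasibleD(2,3)[OF feas[OF that]] by auto
  have base: "A 0 e + int s \<le> A s e" if "s < d" for s e
    using chain_gap[OF A, of 0 s e] that by simp

  \<comment> \<open>A digit is lost only if \<open>B s e\<close> exceeds \<open>A s e\<close> while
    \<open>B s (e + 1) = A s (e + 1)\<close>. Then \<open>A s e = A 0 e + s\<close>, whereas
    \<open>A s (e + 1)\<close> is at least \<open>A 0 (e + 1) + s + b (e + 1)\<close>; so level
    \<open>s\<close> has at least \<open>s * (p - 1)\<close> more digits than the bottom in this
    class.\<close>
  have loss: "cnt (A s) e \<le> cnt (B s) e \<or>
      cnt (B s) e = cnt (A s) e - 1 \<and> b e = 1 \<and>
      n0 e + int s * (int p - 1) + int p * b (e + 1) \<le> cnt (A s) e" if s: "s < d" for s e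
  proof -
    have "x s e = A s e \<or> x s e = A 0 e + int s + b e \<and> A s e < A 0 e + int s + b e"
      unfolding x_def by linarith
    then consider "B s e = int p * B s (e + 1) - cap e" | "B s e = A s e"
      | "B s e = A 0 e + int s + b e" "A s e < A 0 e + int s + b e"
      using least_closedD(4)[OF B[OF s], of e] by metis
    then show ?thesis
    proof cases
      case 1 then show ?thesis using capA(1)[OF s, of e] by (simp add: cnt_def)
    next
      case 2 then show ?thesis using p_mult_mono[OF BA[OF s, of "e + 1"]] by (simp add: cnt_def)
    next
      case 3
      then have be: "b e = 1" "A s e = A 0 e + int s" "B s e = A s e + 1"
        using base[OF s, of e] b(2)[of e] by auto
      show ?thesis
      proof (cases "B s (e + 1) = A s (e + 1)")
        case True
        have "int p * (A 0 (e + 1) + int s + b (e + 1)) \<le> int p * A s (e + 1)"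
          using Bb[OF s, of "e + 1"] True by (intro p_mult_mono) simp
        then show ?thesis using True be by (simp add: cnt_def n0_def algebra_simps)
      next
        case False
        then have "int p * (A s (e + 1) + 1) \<le> int p * B s (e + 1)"
          using BA[OF s, of "e + 1"] by (intro p_mult_mono) simp
        then show ?thesis using be p_ge2 by (simp add: cnt_def algebra_simps)
      qed
    qed
  qed
  have cnt_c0: "0 \<le> cnt c e" for e using feasibleD(2)[OF feas_c] .
  \<comment> \<open>At the end of the run \<open>g (e + 1) = 0\<close>, so \<open>c\<close> has
    fewer digits than \<open>A 0\<close> there and the half bound from \<open>j\<close>
    applies.\<close>
  have edge: "1 \<le> n0 e" "2 * gain (e mod f) (n0 e - 1) \<le> int p ^ j"
    if be: "b e = 1" "b (e + 1) = 0" for e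
  proof -
    obtain e0 where e0: "g e0 \<ge> 1" "g (e0 + 1) = 0" "e mod f = e0 mod f"
      using b(5) be by (metis zero_neq_one)
    have e0': "g e \<ge> 1" "g (e + 1) = 0"
      using e0 periodic_cong[OF perg, of e e0] periodic_cong[OF perg, of "e + 1" "e0 + 1"]
      by (metis mod_add_left_eq)+
    have lt: "cnt c e < n0 e" using cnt_c[of e] e0' by simp
    then show "1 \<le> n0 e" using cnt_c0[of e] by linarith
    show "2 * gain (e mod f) (n0 e - 1) \<le> int p ^ j"
      using j(4)[of "e mod f"] lt f_pos periodic_mod[OF per_n0, of e]
        periodic_mod[OF cnt_periodic[OF perc], of e] by simp
  qed
  have chB: "chain d B"
    unfolding chain_def
  proof (intro conjI allI impI)
    fix s assume s: "s < d"
    have "0 \<le> cnt (B s) e" for e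
    proof (cases "cnt (A s) e \<le> cnt (B s) e")
      case True then show ?thesis using capA(2)[OF s, of e] by linarith
    next
      case False
      then have l: "cnt (B s) e = cnt (A s) e - 1" "b e = 1"
        "n0 e + int s * (int p - 1) + int p * b (e + 1) \<le> cnt (A s) e" using loss[OF s, of e] by auto
      have "0 \<le> int s * (int p - 1)" using p_ge2 by simp
      moreover have "1 \<le> n0 e + int p * b (e + 1)"
        using b(2)[of "e + 1"] edge(1)[of e] l(2) n0(1)[of e] p_ge2 by auto
      ultimately show ?thesis using l by linarith
    qed
    then show "feasible (B s)"
      using cap_B[OF s] least_closedD(1)[OF B[OF s]] by (simp add: feasible_def)
  next
    fix e show "1 \<le> B 0 e" using BA[OF d, of e] chainD(2)[OF A d, of e] by linarith
  next
    fix s e assume s: "Suc s < d"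
    then have s': "s < d" by simp
    \<comment> \<open>\<open>B (Suc s) - 1\<close> competes in the closure defining
      \<open>B s\<close>: subtracting the constant preserves the closure inequality because
      \<open>p \<ge> 1\<close>.\<close>
    have "B s e \<le> B (Suc s) e - 1"
    proof (rule least_closed_le[OF B[OF s']])
      show "periodic f (\<lambda>e. B (Suc s) e - 1)"
        using least_closedD(1)[OF B[OF s]] by (simp add: periodic_def)
      show "x s e \<le> B (Suc s) e - 1" for e
        using chainD(3)[OF A s, of e] least_closedD(2)[OF B[OF s], of e] by (simp add: x_def)
      show "int p * (B (Suc s) (e + 1) - 1) - cap e \<le> B (Suc s) e - 1" for e
        using least_closedD(3)[OF B[OF s], of e] p_ge2 by (simp add: algebra_simps)
    qed
    then show "B s e + 1 \<le> B (Suc s) e" by linarith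
  qed
  \<comment> \<open>\<open>T s e\<close> is the change in value of class \<open>e\<close> at level
    \<open>s\<close>, and \<open>S e\<close> its total over all levels.\<close>
  define T where "T s e = part e (cnt (B s) e) - part e (cnt (A s) e)" for s e
  define S where "S e = (\<Sum>s<d. T s e)" for e
  have Tcases: "0 \<le> T s e \<or> b e = 1 \<and> T s e = - gain e (cnt (A s) e - 1) \<and>
      n0 e + int s * (int p - 1) + int p * b (e + 1) \<le> cnt (A s) e" if s: "s < d" for s e
    using loss[OF s, of e] part_mono[of "cnt (A s) e" "cnt (B s) e" e]
    by (auto simp: T_def gain_def)
  \<comment> \<open>Raising coordinate \<open>e + 1\<close> adds at least \<open>p\<close> digits
    and raising \<open>e\<close> removes at most one, unless the closure fills the class up to
    \<open>cap\<close>. If \<open>n0 e\<close> was already \<open>cap e\<close>, rank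
    \<open>n0 e\<close> has gain zero.\<close>
  have bottom: "gain e (n0 e) \<le> T 0 e" if e: "e < f" "b (e + 1) = 1" for e
  proof -
    consider "B 0 e = int p * B 0 (e + 1) - cap e" | "B 0 e = A 0 e + b e"
      using least_closedD(4)[OF B[OF d], of e] b(2)[of e] by (auto simp: x_def)
    then have "cnt (B 0) e = cap e \<or> n0 e + 1 \<le> cnt (B 0) e"
    proof cases
      case 1 then show ?thesis by (simp add: cnt_def)
    next
      case 2
      have "int p * (A 0 (e + 1) + 1) \<le> int p * B 0 (e + 1)"
        using Bb[OF d, of "e + 1"] e(2) by (intro p_mult_mono) simp
      then show ?thesis using 2 p_ge2 b(2)[of e] by (auto simp: cnt_def n0_def algebra_simps)
    qed
    moreover have "gain e (n0 e) = 0" if "\<not> n0 e + 1 \<le> cap e"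
      using that e(1) by (intro gain_zero) (auto simp: cap_def)
    moreover have "gain e (n0 e) \<le> T 0 e" if "n0 e + 1 \<le> cnt (B 0) e"
      using part_mono[OF that, of e] by (simp add: T_def gain_def n0_def)
    moreover have "0 \<le> T 0 e" if "cnt (B 0) e = cap e"
      using part_mono[OF n0(2)[of e], of e] that by (simp add: T_def n0_def)
    ultimately show ?thesis by force
  qed
  have gain_bound: "2 ^ t * gain e (cnt (A s) e - 1) \<le> gain e m"
    if "e < f" "0 \<le> m" "m + int t * (int p - 1) \<le> cnt (A s) e - 1" for s e t m
  proof -
    have "2 ^ t * gain e (cnt (A s) e - 1) \<le> 2 ^ t * gain e (m + int t * (int p - 1))"
      using gain_antimono[OF that(3)] by (intro mult_left_mono) auto
    also have "\<dots> \<le> gain e m" using gain_halves_iterate that by blast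
    finally show ?thesis .
  qed
  have no_loss: "0 \<le> S e" if "b e = 0" for e
    unfolding S_def using Tcases that by (intro sum_nonneg) force
  \<comment> \<open>With \<open>z = gain e (n0 e)\<close>, the bottom wins at least \<open>z\<close>
    and level \<open>s \<ge> 1\<close> loses at most \<open>z / 2 ^ s\<close>, which leaves
    \<open>z / 2 ^ (d - 1)\<close>. Doubling \<open>T (Suc r) e\<close> fits the levels from
    \<open>1\<close> on to the geometric bound.\<close>
  have inner: "gain e (n0 e) \<le> 2 ^ (d - 1) * S e" if e: "e < f" "b e = 1" "b (e + 1) = 1" for e
  proof -
    have dm: "d = Suc (d - 1)" using d by simp
    have "S e = T 0 e + (\<Sum>r<d - 1. T (Suc r) e)"
      unfolding S_def by (subst dm, subst sum.lessThan_Suc_shift) simp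
    moreover have "- (2 * (2 ^ (d - 1) - 1)) * gain e (n0 e) \<le> 2 ^ (d - 1) * (\<Sum>r<d - 1. 2 * T (Suc r) e)"
    proof (rule geometric_loss_bound)
      fix r assume r: "r < d - 1"
      then have s: "Suc r < d" by simp
      have gn: "0 \<le> gain e (n0 e)" by (rule gain_nonneg)
      show "- gain e (n0 e) \<le> 2 ^ r * (2 * T (Suc r) e)"
      proof (cases "0 \<le> T (Suc r) e")
        case True
        then have "0 \<le> 2 ^ r * (2 * T (Suc r) e)" by simp
        then show ?thesis using gn by linarith
      next
        case False
        then have T: "T (Suc r) e = - gain e (cnt (A (Suc r)) e - 1)"
          "n0 e + int (Suc r) * (int p - 1) + int p * b (e + 1) \<le> cnt (A (Suc r)) e"
          using Tcases[OF s, of e] by auto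
        have "2 ^ Suc r * gain e (cnt (A (Suc r)) e - 1) \<le> gain e (n0 e)"
          using T(2) e p_ge2 by (intro gain_bound n0(1)) auto
        then show ?thesis using T(1) by simp
      qed
    qed
    moreover have "2 ^ (d - 1) * gain e (n0 e) \<le> 2 ^ (d - 1) * T 0 e"
      using bottom[OF e(1,3)] by (intro mult_left_mono) auto
    moreover have "g' \<le> P * (t + X)" if "- (2 * (P - 1)) * g' \<le> P * (2 * X)" "P * g' \<le> P * t"
      for P X g' t :: int
    proof -
      have "- (2 * (P - 1)) * g' = 2 * g' - 2 * (P * g')" "P * (2 * X) = 2 * (P * X)"
        "P * (t + X) = P * t + P * X" by (simp_all add: algebra_simps)
      then show ?thesis using that by linarith
    qed
    ultimately show ?thesis by (simp add: sum_distrib_left[symmetric])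
  qed
  \<comment> \<open>Here level \<open>0\<close> may lose as well, so the losses are at most
    \<open>z / 2 ^ s\<close> for all \<open>s < d\<close>. Their sum stays below
    \<open>2 * z \<le> p ^ j\<close>, or is zero if \<open>z = 0\<close>.\<close>
  have outer: "0 < S e + int p ^ j" if e: "e < f" "b e = 1" "b (e + 1) = 0" for e
  proof -
    define z where "z = gain e (n0 e - 1)"
    have z: "0 \<le> z" "2 * z \<le> int p ^ j" using gain_nonneg edge(2)[OF e(2,3)] e(1) by (simp_all add: z_def)
    have "- (2 * (2 ^ d - 1)) * z \<le> 2 ^ d * S e"
      unfolding S_def
    proof (rule geometric_loss_bound)
      fix s assume s: "s < d"
      show "- z \<le> 2 ^ s * T s e"
      proof (cases "0 \<le> T s e")
        case True
        then have "0 \<le> 2 ^ s * T s e" by simp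
        then show ?thesis using z by linarith
      next
        case False
        then have T: "T s e = - gain e (cnt (A s) e - 1)"
          "n0 e + int s * (int p - 1) + int p * b (e + 1) \<le> cnt (A s) e"
          using Tcases[OF s, of e] by auto
        have "2 ^ s * gain e (cnt (A s) e - 1) \<le> z"
          unfolding z_def using T(2) e edge(1)[OF e(2,3)] by (intro gain_bound) auto
        then show ?thesis using T(1) by simp
      qed
    qed
    moreover have "0 < P * (S' + Y)" if "- (2 * (P - 1)) * z \<le> P * S'" "0 < P" "0 < Y" and "2 * z \<le> Y" for P S' Y :: int
    proof -
      have "P * (2 * z) \<le> P * Y" using that by (intro mult_left_mono) auto
      moreover have "- (2 * (P - 1)) * z = 2 * z - P * (2 * z)" "P * (S' + Y) = P * S' + P * Y"
        by (simp_all add: algebra_simps)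
      moreover have "0 < P * Y" using that by simp
      ultimately show ?thesis using that(1) z(1) by (cases "z = 0") auto
    qed
    ultimately have "0 < 2 ^ d * (S e + int p ^ j)" using z(2) p_ge2 by simp
    then show ?thesis by (simp add: zero_less_mult_iff)
  qed
  have inner0: "0 \<le> S e" if "e < f" "b e = 1" "b (e + 1) = 1" for e
  proof -
    have "0 \<le> 2 ^ (d - 1) * S e" using inner[OF that] gain_nonneg[of e "n0 e"] by linarith
    then show ?thesis by (simp add: zero_le_mult_iff)
  qed
  define h where "h = j mod f"
  have h: "h < f" "b h = b j" "b (h + 1) = 1" "int p ^ j \<le> gain h (n0 h)"
    using f_pos b(4) periodic_mod[OF b(1), of j] periodic_cong[OF b(1), of "h + 1" "j + 1"] j(3)
      periodic_mod[OF per_n0, of j] by (auto simp: h_def mod_add_left_eq simp del: add_Suc_right)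
  have pj: "0 < int p ^ j" using p_ge2 by simp
  \<comment> \<open>If the run goes all the way round, every class is an inner one and class
    \<open>h\<close> wins. Otherwise \<open>h\<close> is outside the run: it loses at no level while
    its bottom wins \<open>p ^ j\<close>, enough to pay for the single class \<open>l\<close> where
    the run ends.\<close>
  have "0 < (\<Sum>e<f. S e)"
    using b(5)
  proof
    assume all: "\<forall>e. b e = 1"
    have "gain h (n0 h) \<le> 2 ^ (d - 1) * S h" using inner[OF h(1) _ h(3)] all by blast
    then have "0 < 2 ^ (d - 1) * S h" using h(4) pj by linarith
    then have "0 < S h" by (simp add: zero_less_mult_iff)
    then show ?thesis using inner0 all h(1) by (intro sum_pos2[of _ h]) auto
  next
    assume "\<exists>e0. b j = 0 \<and> b e0 = 1 \<and> g e0 \<ge> 1 \<and> g (e0 + 1) = 0 \<and>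
        (\<forall>e. b e = 1 \<longrightarrow> b (e + 1) = 0 \<longrightarrow> e mod f = e0 mod f)"
    then obtain e0 where e0: "b j = 0" "b e0 = 1"
      "g (e0 + 1) = 0" "\<And>e. b e = 1 \<Longrightarrow> b (e + 1) = 0 \<Longrightarrow> e mod f = e0 mod f" by blast
    define l where "l = e0 mod f"
    have be0: "b (e0 + 1) = 0" using b(2)[of "e0 + 1"] b(3)[of "e0 + 1"] e0(3) by auto
    have l: "l < f" "b l = 1" "b (l + 1) = 0"
      using f_pos e0(2) be0 periodic_mod[OF b(1), of e0] periodic_cong[OF b(1), of "l + 1" "e0 + 1"]
      by (auto simp: l_def mod_Suc_eq)
    have "h \<noteq> l" using l(2) h(2) e0(1) by auto
    have "int p ^ j \<le> T 0 h" using bottom[of h] h by linarith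
    also have "\<dots> \<le> S h"
      unfolding S_def using d Tcases[of _ h] h(2) e0(1)
      by (intro member_le_sum) force+
    finally have "int p ^ j \<le> S h" .
    then have "0 < S h + S l" using outer[OF l] by linarith
    also have "\<dots> = (\<Sum>e\<in>{h, l}. S e)" using \<open>h \<noteq> l\<close> by simp
    also have "\<dots> \<le> (\<Sum>e<f. S e)"
    proof (rule sum_mono2)
      fix e assume e: "e \<in> {..<f} - {h, l}"
      have "\<not> (b e = 1 \<and> b (e + 1) = 0)" using e0(4)[of e] e l_def by auto
      then show "0 \<le> S e" using no_loss[of e] inner0[of e] b(2)[of e] b(2)[of "e + 1"] e by auto
    qed (use h l in auto)
    finally show ?thesis .
  qed
  also have "(\<Sum>e<f. S e) = (\<Sum>s<d. \<Sum>e<f. T s e)"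
    unfolding S_def by (rule sum.swap)
  also have "\<dots> = score d B - score d A"
    unfolding score_def sum_subtractf[symmetric] T_def
  proof (intro sum.cong refl)
    fix s assume "s \<in> {..<d}"
    then have "s < d" by simp
    then show "(\<Sum>e<f. part e (cnt (B s) e) - part e (cnt (A s) e)) = best (cnt (B s)) - best (cnt (A s))"
      using best_parts[OF cnt_periodic[OF perA]] best_parts[OF cnt_periodic[OF least_closedD(1)[OF B]]]
      by (simp add: sum_subtractf)
  qed
  finally show ?thesis using that[OF chB] by simp
qed

text \<open>Replacing the bottom of \<open>A\<close> by its meet with \<open>C 0\<close> gives a
  chain, so the meet is no better than \<open>A 0\<close>. If \<open>C 0\<close> were better,
  supermodularity would make the join better too, and \<open>improve_bottom\<close> applies to the
  join.\<close>

lemma optimal_chain_bottom: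
  assumes A: "chain d A" and C: "chain d C" and d: "0 < d"
    and opt: "\<And>B. chain d B \<Longrightarrow> score d B \<le> score d A"
  shows "best (cnt (C 0)) \<le> best (cnt (A 0))"
proof (rule ccontr)
  assume "\<not> ?thesis"
  then have less: "best (cnt (A 0)) < best (cnt (C 0))" by simp
  define c where "c e = max (A 0 e) (C 0 e)" for e
  define l where "l e = min (A 0 e) (C 0 e)" for e
  have feas: "feasible (A 0)" "feasible (C 0)" using chainD(1)[OF A] chainD(1)[OF C] d by auto
  have "chain d (A(0 := l))"
    using feasible_max_min(2)[OF feas] chainD(2)[OF A] chainD(2)[OF C] d
    by (intro chain_replace_bottom[OF A]) (auto simp: l_def[abs_def])
  then have "best (cnt l) \<le> best (cnt (A 0))"
    using opt score_update[of 0 d A l] d by fastforce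
  then have "best (cnt (A 0)) < best (cnt c)"
    using best_max_min[of "A 0" "C 0"] less by (simp add: c_def[abs_def] l_def[abs_def])
  moreover have "c e + int (d - 1) \<le> max (A (d - 1) e) (C (d - 1) e)" for e
    using chain_gap[OF A, of 0 "d - 1" e] chain_gap[OF C, of 0 "d - 1" e] d by (auto simp: c_def)
  moreover have "feasible c" using feasible_max_min(1)[OF feas] by (simp add: c_def[abs_def])
  ultimately obtain B where "chain d B" "score d A < score d B"
    using improve_bottom[OF A C d, of c] by (auto simp: c_def)
  then show False using opt by force
qed

section \<open>Tuples and chains\<close>

abbreviation q :: nat where "q \<equiv> p ^ f"

lemma q_ge2: "2 \<le> q"
proof -
  have "p ^ 1 \<le> p ^ f" using p_ge2 f_pos by (intro power_increasing) auto
  then show ?thesis using p_ge2 by simp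
qed

section \<open>Coordinates of a number\<close>

definition counts :: "nat \<Rightarrow> nat \<Rightarrow> int" where
  "counts n e = tail (dig n) (e mod f)"

text \<open>On \<open>cnt c\<close> with periodic \<open>c\<close> this sum telescopes to
  \<open>(q - 1) * c e\<close>; the division by \<open>q - 1\<close> in \<open>coord\<close>
  therefore inverts \<open>cnt\<close>.\<close>

definition class_sum :: "(nat \<Rightarrow> int) \<Rightarrow> nat \<Rightarrow> int" where
  "class_sum v e = (\<Sum>t<f. v (e + t) * int p ^ t)"

definition coord :: "nat \<Rightarrow> nat \<Rightarrow> int" where
  "coord n e = class_sum (counts n) e div (int q - 1)"

lemma weight_dig: "n < p ^ K \<Longrightarrow> weight (dig n) = int n"
  using arg_cong[OF sum_digits[of p n K], of int] by (simp add: weight_def dig_def)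

lemma class_sum_step:
  assumes "v (e + f) = v e - x"
  shows "int p * class_sum v (e + 1) = class_sum v e + (int q - 1) * v e - int q * x"
proof -
  have "int p * class_sum v (e + 1) = (\<Sum>t<f. v (e + Suc t) * int p ^ Suc t)"
    by (simp add: class_sum_def sum_distrib_left mult_ac)
  also have "\<dots> + v e = (\<Sum>t<Suc f. v (e + t) * int p ^ t)"
    by (subst sum.lessThan_Suc_shift) simp
  also have "\<dots> = class_sum v e + v (e + f) * int q"
    by (simp add: class_sum_def)
  finally show ?thesis using assms by (simp add: algebra_simps)
qed

text \<open>Modulo \<open>q - 1\<close> the power \<open>p ^ i\<close> depends only on the class of
  \<open>i\<close>, so a number is congruent to its class sum.\<close>

lemma class_sum_dvd_iff:
  assumes "n < p ^ K"
  shows "int q - 1 dvd class_sum (counts n) 0 \<longleftrightarrow> (q - 1) dvd n"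
proof -
  \<comment> \<open>The tails from position \<open>i\<close> on represent
    \<open>n div p ^ i\<close>. Modulo \<open>q - 1\<close> both terms obey the same recursion from
    \<open>i + 1\<close> down to \<open>i\<close>.\<close>
  have "int q - 1 dvd class_sum (tail (dig n)) i - int (n div p ^ i)" for i
  proof (induction "K - i" arbitrary: i rule: less_induct)
    case less
    show ?case
    proof (cases "K \<le> i")
      case True
      then have "tail (dig n) (i + t) = 0" for t
        using dig_beyond[OF assms] by (intro tail_beyond) auto
      moreover have "n div p ^ i = 0"
      proof -
        have "p ^ K \<le> p ^ i" using True p_ge2 by (intro power_increasing) auto
        then show ?thesis using assms by simp
      qed
      ultimately show ?thesis by (simp add: class_sum_def)
    next
      case False
      have "tail (dig n) (i + f) = tail (dig n) i - dig n i"
        using tail_step[of "dig n" i] dig_beyond[OF assms] by simp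
      from class_sum_step[of "tail (dig n)", OF this]
      have "class_sum (tail (dig n)) i = int p * class_sum (tail (dig n)) (i + 1)
          - (int q - 1) * tail (dig n) i + int q * dig n i" by simp
      moreover have "int (n div p ^ i) = int p * int (n div p ^ (i + 1)) + dig n i"
      proof -
        have "n div p ^ i = p * (n div p ^ i div p) + n div p ^ i mod p" by simp
        also have "n div p ^ i div p = n div p ^ (i + 1)"
          by (simp add: div_mult2_eq[symmetric] mult.commute)
        finally show ?thesis unfolding dig_def digit_def by (metis of_nat_add of_nat_mult)
      qed
      ultimately have "class_sum (tail (dig n)) i - int (n div p ^ i)
          = int p * (class_sum (tail (dig n)) (i + 1) - int (n div p ^ (i + 1)))
            + (int q - 1) * (dig n i - tail (dig n) i)" by (simp add: algebra_simps)
      moreover have "int q - 1 dvd class_sum (tail (dig n)) (i + 1) - int (n div p ^ (i + 1))"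
        using False by (intro less) auto
      ultimately show ?thesis by simp
    qed
  qed
  from this[of 0] have "int q - 1 dvd class_sum (tail (dig n)) 0 - int n" by simp
  moreover have "class_sum (tail (dig n)) 0 = class_sum (counts n) 0"
    by (simp add: class_sum_def counts_def)
  ultimately have "int q - 1 dvd class_sum (counts n) 0 \<longleftrightarrow> int q - 1 dvd int n"
    by (metis dvd_diff_commute diff_add_cancel dvd_add_right_iff)
  also have "\<dots> \<longleftrightarrow> int (q - 1) dvd int n" using q_ge2 by (simp add: of_nat_diff)
  finally show ?thesis by simp
qed

lemma counts_periodic: "periodic f (counts n)"
  by (simp add: periodic_def counts_def)

lemma counts_nonneg: "0 \<le> counts n e"
  unfolding counts_def by (intro tail_nonneg dig_bounds)

text \<open>The class sum at \<open>e\<close> and \<open>p\<close> times the class sum at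
  \<open>e + 1\<close> agree modulo \<open>q - 1\<close>, where \<open>p\<close> is invertible; so
  divisibility spreads from \<open>0\<close> to all \<open>e\<close>.\<close>

lemma class_sum_coord:
  assumes "n < p ^ K" "(q - 1) dvd n"
  shows "class_sum (counts n) e = (int q - 1) * coord n e"
proof -
  have "int q - 1 dvd class_sum (counts n) e"
  proof (induction e)
    case 0 then show ?case using class_sum_dvd_iff[OF assms(1)] assms(2) by simp
  next
    case (Suc e)
    have "int p * class_sum (counts n) (e + 1) = class_sum (counts n) e + (int q - 1) * counts n e"
      using class_sum_step[of "counts n" e 0] periodicD[OF counts_periodic] by simp
    then have "int q - 1 dvd int p * class_sum (counts n) (Suc e)" using Suc by simp
    moreover have "coprime (int q - 1) (int p)"
    proof (rule coprimeI)
      fix c assume c: "c dvd int q - 1" "c dvd int p"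
      then have "c dvd int q" using f_pos by (auto intro: dvd_trans)
      then have "c dvd int q - (int q - 1)" using c(1) by (rule dvd_diff)
      then show "is_unit c" by simp
    qed
    ultimately show ?case by (simp add: coprime_dvd_mult_right_iff)
  qed
  then show ?thesis unfolding coord_def by simp
qed

lemma class_sum_nonneg: "0 \<le> class_sum (counts n) e"
  unfolding class_sum_def using counts_nonneg by (intro sum_nonneg) auto

lemma tail_le_counts:
  assumes "n < p ^ K"
  shows "tail (dig n) i \<le> counts n i"
proof -
  have step: "tail (dig n) (i + f) \<le> tail (dig n) i" for i
    using tail_step[of "dig n" i] dig_beyond[OF assms] dig_bounds(1)[of n i] by simp
  have "tail (dig n) (i + m * f) \<le> tail (dig n) i" for i m
  proof (induction m)
    case (Suc m)
    then show ?case using step[of "i + m * f"] by (simp add: algebra_simps)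
  qed simp
  from this[of "i mod f" "i div f"] show ?thesis by (simp add: counts_def)
qed

lemma coord_facts:
  assumes "n < p ^ K" "(q - 1) dvd n"
  shows "periodic f (coord n)" "cnt (coord n) e = counts n e" "0 < n \<Longrightarrow> 1 \<le> coord n e"
proof -
  note cs = class_sum_coord[OF assms]
  have q1: "0 < int q - 1" using q_ge2 by linarith
  show "periodic f (coord n)"
  proof -
    have "counts n (i + f + t) = counts n (i + t)" for i t
      using periodicD[OF counts_periodic, of n "i + t"] by (simp add: algebra_simps)
    then show ?thesis by (simp add: periodic_def coord_def class_sum_def)
  qed
  have "int p * class_sum (counts n) (e + 1) = class_sum (counts n) e + (int q - 1) * counts n e"
    using class_sum_step[of "counts n" e 0] periodicD[OF counts_periodic] by simp
  then have "(int q - 1) * (int p * coord n (e + 1)) = (int q - 1) * (coord n e + counts n e)"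
    unfolding cs by (simp add: algebra_simps)
  then have "int p * coord n (e + 1) = coord n e + counts n e" using q1 by simp
  then show "cnt (coord n) e = counts n e" by (simp add: cnt_def)
  show "1 \<le> coord n e" if "0 < n"
  proof (rule ccontr)
    \<comment> \<open>A nonpositive coordinate makes the nonnegative class sum vanish, hence all
      counts and tails, and finally the weight, which is \<open>n\<close> itself.\<close>
    assume "\<not> 1 \<le> coord n e"
    then have "(int q - 1) * coord n e \<le> 0" using q1 by (intro mult_nonneg_nonpos) linarith+
    then have "class_sum (counts n) e = 0" using class_sum_nonneg[of n e] cs[of e] by simp
    then have z: "counts n (e + t) = 0" if "t < f" for t
      using counts_nonneg p_ge2 that unfolding class_sum_def
      by (subst (asm) sum_nonneg_eq_0_iff) auto
    have "counts n i = 0" for i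
    proof -
      obtain t where t: "t < f" "(e + t) mod f = i mod f"
      proof (rule that)
        show "(i + (f - e mod f)) mod f < f" using f_pos by simp
        have "(e + (i + (f - e mod f)) mod f) mod f = (e mod f + (i + (f - e mod f))) mod f"
          by (simp add: mod_simps)
        also have "e mod f + (i + (f - e mod f)) = i + f" using mod_le_divisor[OF f_pos, of e] by simp
        finally show "(e + (i + (f - e mod f)) mod f) mod f = i mod f" by simp
      qed
      show ?thesis using z[OF t(1)] periodic_cong[OF counts_periodic t(2)] by simp
    qed
    then have "tail (dig n) i = 0" for i
      using tail_le_counts[OF assms(1), of i] tail_nonneg[of "dig n" i] dig_bounds(1) by force
    then have "weight (dig n) = 0"
      using weight_tail[of "dig n"] dig_beyond[OF assms(1)] by simp
    then show False using weight_dig[OF assms(1)] that by simp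
  qed
qed

section \<open>From tuples to chains\<close>

lemma tail_sum: "tail (\<lambda>i. \<Sum>r\<in>R. x r i) e = (\<Sum>r\<in>R. tail (x r) e)"
  unfolding tail_def by (rule sum.swap)

lemma weight_sum: "weight (\<lambda>i. \<Sum>r\<in>R. x r i) = (\<Sum>r\<in>R. weight (x r))"
  unfolding weight_def sum_distrib_right by (rule sum.swap)

lemma U_setD:
  assumes "m \<in> U_set p q d k"
  shows "length m = d + 1" "sum_list m = k" "(\<Sum>i\<le>d. dig (m ! i) t) = dig k t"
    "1 \<le> i \<Longrightarrow> i \<le> d \<Longrightarrow> 0 < m ! i" "1 \<le> i \<Longrightarrow> i \<le> d \<Longrightarrow> (q - 1) dvd m ! i"
    "i \<le> d \<Longrightarrow> m ! i < p ^ K"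
proof -
  show l: "length m = d + 1" and s: "sum_list m = k"
    using assms by (auto simp: U_set_def sums_without_carry_def)
  have "(\<Sum>x\<leftarrow>m. digit p x t) = digit p k t"
    using assms by (simp add: U_set_def sums_without_carry_def)
  then show "(\<Sum>i\<le>d. dig (m ! i) t) = dig k t"
    unfolding sum_list_nth l by (simp add: dig_def lessThan_Suc_atMost flip: of_nat_sum)
  show "1 \<le> i \<Longrightarrow> i \<le> d \<Longrightarrow> 0 < m ! i" "1 \<le> i \<Longrightarrow> i \<le> d \<Longrightarrow> (q - 1) dvd m ! i"
    using assms by (auto simp: U_set_def)
  show "m ! i < p ^ K" if "i \<le> d"
  proof -
    have "m ! i \<le> sum_list m" using l that by (intro member_le_sum_list) auto
    then show ?thesis using s k_less by simp
  qed
qed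

text \<open>Counts and coordinates add up over the entries, and without carries the partial digit
  sums stay below the digits of \<open>k\<close>. Each entry from \<open>1\<close> to
  \<open>d\<close> is positive and \<open>q\<close>-even, so it adds at least \<open>1\<close> to
  every coordinate, which is the gap condition.\<close>

lemma chain_of_tuple:
  assumes m: "m \<in> U_set p q d k"
  defines "A \<equiv> \<lambda>s e. \<Sum>r\<le>s. coord (m ! (d - r)) e"
  shows "chain d A"
    and "\<And>s. s < d \<Longrightarrow> int (\<Sum>r\<le>s. m ! (d - r)) \<le> best (cnt (A s))"
proof -
  note U = U_setD[OF m]
  have idx: "1 \<le> d - r" "d - r \<le> d" if "r \<le> s" "s < d" for r s using that by auto
  have cnt_A: "cnt (A s) e = (\<Sum>r\<le>s. counts (m ! (d - r)) e)" if "s < d" for s e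
  proof -
    have "cnt (A s) e = (\<Sum>r\<le>s. cnt (coord (m ! (d - r))) e)"
      by (simp add: A_def cnt_def sum_subtractf sum_distrib_left)
    also have "\<dots> = (\<Sum>r\<le>s. counts (m ! (d - r)) e)"
      using that by (intro sum.cong refl coord_facts(2) U(5,6) idx) auto
    finally show ?thesis .
  qed
  have partial: "(\<Sum>r\<le>s. dig (m ! (d - r)) t) \<le> dig k t" if "s < d" for s t
  proof -
    have "(\<Sum>r\<le>s. dig (m ! (d - r)) t) = (\<Sum>i\<in>(\<lambda>r. d - r) ` {..s}. dig (m ! i) t)"
      using that by (subst sum.reindex) (auto simp: inj_on_def)
    also have "\<dots> \<le> (\<Sum>i\<le>d. dig (m ! i) t)"
      using dig_bounds by (intro sum_mono2) auto
    finally show ?thesis using U(3) by simp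
  qed
  show "chain d A"
    unfolding chain_def
  proof (intro conjI allI impI)
    fix s assume s: "s < d"
    have "periodic f (A s)"
      using coord_facts(1)[OF U(6) U(5)] idx s
      unfolding A_def periodic_def by (auto intro!: sum.cong)
    moreover have "cnt (A s) e \<le> cap e" for e
    proof -
      have "cnt (A s) e = tail (\<lambda>t. \<Sum>r\<le>s. dig (m ! (d - r)) t) (e mod f)"
        unfolding cnt_A[OF s] counts_def tail_sum ..
      also have "\<dots> \<le> tail (dig k) (e mod f)" using partial[OF s] by (rule tail_mono)
      finally show ?thesis by (simp add: cap_def N_def)
    qed
    moreover have "0 \<le> cnt (A s) e" for e
      unfolding cnt_A[OF s] using counts_nonneg by (intro sum_nonneg)
    ultimately show "feasible (A s)" by (simp add: feasible_def)
  next
    fix e assume "0 < d" then show "1 \<le> A 0 e"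
      using coord_facts(3)[OF U(6) U(5) U(4)] by (simp add: A_def)
  next
    fix s e assume "Suc s < d"
    then show "A s e + 1 \<le> A (Suc s) e"
      using coord_facts(3)[OF U(6) U(5) U(4), of "d - Suc s" e] by (simp add: A_def)
  qed
  fix s assume s: "s < d"
  have "int (\<Sum>r\<le>s. m ! (d - r)) = (\<Sum>r\<le>s. weight (dig (m ! (d - r))))"
    using U(6) by (simp add: weight_dig)
  also have "\<dots> = weight (\<lambda>t. \<Sum>r\<le>s. dig (m ! (d - r)) t)" by (rule weight_sum[symmetric])
  also have "\<dots> \<le> best (cnt (A s))"
  proof (rule weight_le_best)
    show "0 \<le> (\<Sum>r\<le>s. dig (m ! (d - r)) i)" for i using dig_bounds by (intro sum_nonneg)
    show "(\<Sum>r\<le>s. dig (m ! (d - r)) i) \<le> dig k i" for i by (rule partial[OF s])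
    show "tail (\<lambda>i. \<Sum>r\<le>s. dig (m ! (d - r)) i) i \<le> cnt (A s) i" for i
      unfolding tail_sum cnt_A[OF s] using U(6) by (intro sum_mono tail_le_counts) simp
  qed
  finally show "int (\<Sum>r\<le>s. m ! (d - r)) \<le> best (cnt (A s))" .
qed

lemma tuple_score_le:
  assumes m: "m \<in> U_set p q d k"
  defines "A \<equiv> \<lambda>s e. \<Sum>r\<le>s. coord (m ! (d - r)) e"
  shows "int (tuple_score m) = (\<Sum>s<d. int (\<Sum>r\<le>s. m ! (d - r)))"
    "int (tuple_score m) \<le> score d A"
proof -
  show 1: "int (tuple_score m) = (\<Sum>s<d. int (\<Sum>r\<le>s. m ! (d - r)))"
    using arg_cong[OF sum_of_upper_sums[of "\<lambda>i. m ! i" d], of int] U_setD(1)[OF m]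
    by (simp add: tuple_score_def)
  show "int (tuple_score m) \<le> score d A"
    unfolding 1 score_def A_def using chain_of_tuple(2)[OF m] by (intro sum_mono) simp
qed

section \<open>From chains back to tuples\<close>

definition num :: "(nat \<Rightarrow> int) \<Rightarrow> nat" where
  "num x = (\<Sum>i<K. nat (x i) * p ^ i)"

lemma num_facts:
  assumes "\<And>i. 0 \<le> x i" "\<And>i. x i \<le> dig k i"
  shows "dig (num x) = x" "int (num x) = weight x" "num x < p ^ K"
proof -
  have lt: "nat (x i) < p" for i
    using assms(2)[of i] dig_bounds(2)[of k i] p_ge2 by linarith
  have z: "x i = 0" if "K \<le> i" for i
    using assms(1)[of i] assms(2)[of i] dig_k_beyond[OF that] by linarith
  show "dig (num x) = x"
  proof
    fix i show "dig (num x) i = x i"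
      using digit_sum_powers[of "\<lambda>i. nat (x i)" p K i, OF lt] assms(1)[of i] z[of i]
      by (simp add: dig_def num_def)
  qed
  show w: "int (num x) = weight x" using assms(1) by (simp add: num_def weight_def)
  have "weight x \<le> weight (dig k)"
    unfolding weight_def using assms(2) by (intro sum_mono mult_right_mono) auto
  then show "num x < p ^ K" using w weight_dig[OF k_less] k_less by simp
qed

text \<open>\<open>best (cnt c)\<close> is the number with digits \<open>sat (cnt c)\<close>, whose
  class sum at \<open>0\<close> telescopes to \<open>(q - 1) * c 0\<close>.\<close>

lemma even_best:
  assumes "feasible c"
  shows "int q - 1 dvd best (cnt c)"
proof -
  define v where "v = cnt c"
  have v: "periodic f v" "\<And>i. 0 \<le> v i" "\<And>i. v i \<le> cap i"
    using assms feasibleD cnt_periodic by (auto simp: v_def)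
  have nf: "dig (num (sat v)) = sat v" "int (num (sat v)) = weight (sat v)" "num (sat v) < p ^ K"
    by (rule num_facts; rule sat_nonneg sat_le)+
  have "counts (num (sat v)) e = v e" for e
    using v(3)[of e] periodic_mod[OF v(1), of e]
    by (simp add: counts_def nf(1) tail_sat[OF v(1,2)] cap_def)
  then have "class_sum (counts (num (sat v))) 0 = (\<Sum>t<f. v t * int p ^ t)"
    by (simp add: class_sum_def)
  also have "\<dots> = (\<Sum>t<f. c (Suc t) * int p ^ Suc t - c t * int p ^ t)"
    by (simp add: v_def cnt_def algebra_simps)
  also have "\<dots> = c f * int p ^ f - c 0"
    using sum_lessThan_telescope[of "\<lambda>t. c t * int p ^ t" f] by simp
  also have "\<dots> = (int q - 1) * c 0"
    using periodicD[OF feasibleD(1)[OF assms], of 0] by (simp add: algebra_simps)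
  finally have "(q - 1) dvd num (sat v)" using class_sum_dvd_iff[OF nf(3)] by simp
  then have "int (q - 1) dvd int (num (sat v))" by simp
  then show ?thesis
    using nf(2) weight_sat[OF v(1,2)] q_ge2 by (simp add: v_def of_nat_diff)
qed

text \<open>Nested counts give digitwise nested saturated selections. Their successive differences
  are the entries from \<open>m ! d\<close> downwards, the digits of \<open>k\<close> left over form
  \<open>m ! 0\<close>, and the partial sums attain \<open>best\<close> at every level.\<close>

lemma tuple_of_chain:
  assumes A: "chain d A" and nested: "\<And>s e. Suc s < d \<Longrightarrow> cnt (A s) e \<le> cnt (A (Suc s)) e"
  obtains m where "m \<in> U_set p q d k" "int (tuple_score m) = score d A"
proof -
  \<comment> \<open>The index is shifted by one: \<open>X 0\<close> is empty and
    \<open>X (Suc d)\<close> is all of \<open>k\<close>, so \<open>D s\<close> holds the digits of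
    \<open>m ! (d - s)\<close> also for \<open>s = 0\<close> and \<open>s = d\<close>.\<close>
  define X where "X s = (if s = 0 then (\<lambda>_. 0) else if s \<le> d then sat (cnt (A (s - 1))) else dig k)" for s
  define D where "D s i = X (Suc s) i - X s i" for s i
  have feas: "feasible (A s)" if "s < d" for s using chainD(1)[OF A that] .
  have X_nonneg: "0 \<le> X s i" for s i using sat_nonneg dig_bounds by (simp add: X_def)
  have X_le: "X s i \<le> dig k i" for s i using sat_le dig_bounds by (simp add: X_def)
  have D_nonneg: "0 \<le> D s i" for s i
  proof -
    consider "s = 0" | t where "s = Suc t" "Suc t < d" | "d \<le> s" "s \<noteq> 0"
      by (metis not0_implies_Suc not_less)
    then show ?thesis
    proof cases
      case 1 then show ?thesis using X_nonneg[of 1 i] by (simp add: D_def X_def)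
    next
      case 2 then show ?thesis using sat_mono[of "cnt (A t)" i "cnt (A (Suc t))"] nested[of t i] by (simp add: D_def X_def)
    next
      case 3 then show ?thesis using X_le[of s i] by (simp add: D_def X_def)
    qed
  qed
  have D_le: "D s i \<le> dig k i" for s i using X_le[of "Suc s" i] X_nonneg[of s i] by (simp add: D_def)
  have nf: "dig (num (D s)) = D s" "int (num (D s)) = weight (D s)" for s
    by (rule num_facts; rule D_nonneg D_le)+
  have weight_D: "weight (D s) = weight (X (Suc s)) - weight (X s)" for s
    by (simp add: weight_def D_def sum_subtractf left_diff_distrib)
  have weight_X: "weight (X (Suc s)) = best (cnt (A s))" if "s < d" for s
    using that feasibleD(1,2)[OF feas[OF that]]
    by (simp add: X_def weight_sat[OF cnt_periodic])
  have X0: "weight (X 0) = 0" by (simp add: X_def weight_def)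
  define m where "m = map (\<lambda>i. num (D (d - i))) [0..<Suc d]"
  have len: "length m = d + 1" by (simp add: m_def)
  have nth: "m ! i = num (D (d - i))" if "i \<le> d" for i
    using that by (simp add: m_def del: upt_Suc)
  have tele: "(\<Sum>r\<le>s. int (m ! (d - r))) = weight (X (Suc s))" if "s \<le> d" for s
    using that
  proof (induction s)
    case 0 then show ?case by (simp add: nth nf weight_D X0)
  next
    case (Suc s) then show ?case by (simp add: nth nf weight_D)
  qed
  have flip: "(\<Sum>i<Suc d. g i) = (\<Sum>r\<le>d. g (d - r))" for g :: "nat \<Rightarrow> 'c::comm_monoid_add"
    by (rule sum.reindex_bij_witness[of _ "\<lambda>i. d - i" "\<lambda>r. d - r"]) auto
  have "int (sum_list m) = (\<Sum>i<Suc d. int (m ! i))"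
    unfolding sum_list_lessThan len by (simp only: Suc_eq_plus1 of_nat_sum)
  also have "\<dots> = (\<Sum>r\<le>d. int (m ! (d - r)))" by (rule flip)
  also have "\<dots> = int k"
    using tele[of d] weight_dig[OF k_less] by (simp add: X_def)
  finally have sum_m: "sum_list m = k" by simp
  have digs: "(\<Sum>x\<leftarrow>m. digit p x i) = digit p k i" for i
  proof -
    have tel: "(\<Sum>r\<le>s. D r i) = X (Suc s) i" for s
      by (induction s) (simp_all add: D_def X_def)
    have "int (\<Sum>x\<leftarrow>m. digit p x i) = (\<Sum>t<Suc d. dig (m ! t) i)"
      unfolding sum_list_nth len by (simp only: Suc_eq_plus1 of_nat_sum dig_def)
    also have "\<dots> = (\<Sum>r\<le>d. dig (m ! (d - r)) i)" by (rule flip)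
    also have "\<dots> = (\<Sum>r\<le>d. D r i)" by (intro sum.cong refl) (simp add: nth nf)
    also have "\<dots> = dig k i" unfolding tel by (simp add: X_def)
    finally show ?thesis by (simp add: dig_def)
  qed
  have even_pos: "0 < m ! i \<and> (q - 1) dvd m ! i" if i: "1 \<le> i" "i \<le> d" for i
  proof -
    define s where "s = d - i"
    have s: "s < d" using i by (simp add: s_def)
    have wD: "int (m ! i) = weight (X (Suc s)) - weight (X s)"
      using i by (simp add: nth nf weight_D s_def)
    have "int q - 1 dvd weight (X t)" if "t \<le> d" for t
      using that X0 weight_X even_best feas by (cases t) auto
    then have "int q - 1 dvd int (m ! i)" using s unfolding wD by (intro dvd_diff) auto
    then have "int (q - 1) dvd int (m ! i)" using q_ge2 by (simp add: of_nat_diff)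
    moreover have "0 < m ! i"
    proof (rule ccontr)
      \<comment> \<open>If the entry were \<open>0\<close>, the coordinate difference
        \<open>B\<close> of neighbouring levels would have all counts zero. Going once round the
        period gives \<open>B 0 = q * B 0\<close>, contrary to \<open>B 0 \<ge> 1\<close>.\<close>
      assume "\<not> 0 < m ! i"
      then have "num (D s) = 0" using i by (simp add: nth s_def)
      then have Dz: "D s t = 0" for t using nf(1)[of s] by (metis dig_def digit_def div_0 mod_0 of_nat_0)
      define B where "B e = (if s = 0 then A 0 e else A s e - A (s - 1) e)" for e
      have perA: "periodic f (A t)" if "t < d" for t using feasibleD(1)[OF feas[OF that]] .
      have perB: "periodic f B" using perA[OF s] perA[of "s - 1"] s by (auto simp: periodic_def B_def)
      have B1: "1 \<le> B e" for e
        using chainD(2)[OF A, of e] chainD(3)[OF A, of "s - 1" e] s by (cases s) (auto simp: B_def)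
      have ts: "tail (sat (cnt (A t))) e = cnt (A t) e" if "t < d" "e < f" for t e
        using feasibleD[OF feas[OF that(1)]] that(2)
        by (simp add: tail_sat[OF cnt_periodic] cap_def min_def)
          (metis cap_def mod_less order_antisym)
      have "tail (D s) e = cnt B e" if "e < f" for e
      proof -
        have "tail (D s) e = tail (X (Suc s)) e - tail (X s) e"
          by (simp add: tail_def D_def sum_subtractf)
        also have "\<dots> = cnt B e"
          using s ts[OF s that] ts[of "s - 1" e] that
          by (cases s) (auto simp: X_def B_def cnt_def tail_def algebra_simps)
        finally show ?thesis .
      qed
      then have "cnt B e = 0" if "e < f" for e using that Dz by (simp add: tail_def)
      then have cB: "cnt B e = 0" for e
        using periodic_mod[OF cnt_periodic[OF perB], of e] f_pos by (metis mod_less_divisor)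
      have "B 0 = int p ^ n * B n" for n
      proof (induction n)
        case (Suc n) then show ?case using cB[of n] by (simp add: cnt_def)
      qed simp
      from this[of f] have "B 0 = int q * B 0" using periodicD[OF perB, of 0] by simp
      moreover have "2 * B 0 \<le> int q * B 0"
        using q_ge2 B1[of 0] by (intro mult_right_mono) linarith+
      ultimately show False using B1[of 0] by linarith
    qed
    ultimately show ?thesis by simp
  qed
  have "m \<in> U_set p q d k"
    using len sum_m digs even_pos by (auto simp: U_set_def sums_without_carry_def)
  moreover have "int (tuple_score m) = score d A"
    unfolding tuple_score_le(1)[OF calculation] score_def
    using tele weight_X by (intro sum.cong refl) simp
  ultimately show ?thesis using that by blast
qed

text \<open>The score of \<open>M\<close> is at most that of its chain, which is at most the optimal
  score; the latter is realised by a tuple, so it is at most the score of \<open>M\<close>. Equality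
  throughout makes the chain of \<open>M\<close> optimal and \<open>M ! d\<close> the best value of
  its bottom.\<close>

lemma optimal_tuple_last:
  assumes O: "M \<in> U_set p q d k" and opt: "\<And>m. m \<in> U_set p q d k \<Longrightarrow> tuple_score m \<le> tuple_score M"
    and m: "m \<in> U_set p q d k" and d: "0 < d"
  shows "m ! d \<le> M ! d"
proof -
  define A where "A s e = (\<Sum>r\<le>s. coord (M ! (d - r)) e)" for s e
  define C where "C s e = (\<Sum>r\<le>s. coord (m ! (d - r)) e)" for s e
  have chA: "chain d A" "\<And>s. s < d \<Longrightarrow> int (\<Sum>r\<le>s. M ! (d - r)) \<le> best (cnt (A s))"
    using chain_of_tuple[OF O] by (simp_all add: A_def[abs_def])
  have chC: "chain d C" "\<And>s. s < d \<Longrightarrow> int (\<Sum>r\<le>s. m ! (d - r)) \<le> best (cnt (C s))"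
    using chain_of_tuple[OF m] by (simp_all add: C_def[abs_def])
  obtain B where B: "chain d B" "\<And>C. chain d C \<Longrightarrow> score d C \<le> score d B"
    "\<And>s e. Suc s < d \<Longrightarrow> cnt (B s) e \<le> cnt (B (Suc s)) e"
    using optimal_nested_chain[OF chA(1)] by blast
  obtain r where r: "r \<in> U_set p q d k" "int (tuple_score r) = score d B"
    using tuple_of_chain[OF B(1,3)] by blast
  have "score d B \<le> int (tuple_score M)" using opt[OF r(1)] r(2) by simp
  moreover have "int (tuple_score M) = (\<Sum>s<d. int (\<Sum>r\<le>s. M ! (d - r)))"
    by (rule tuple_score_le(1)[OF O])
  moreover have le: "(\<Sum>s<d. int (\<Sum>r\<le>s. M ! (d - r))) \<le> score d A"
    unfolding score_def using chA(2) by (intro sum_mono) simp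
  ultimately have BA: "score d B \<le> score d A" and eq: "(\<Sum>s<d. int (\<Sum>r\<le>s. M ! (d - r))) = score d A"
    using B(2)[OF chA(1)] by linarith+
  have "int (M ! d) = best (cnt (A 0))"
  proof (rule ccontr)
    assume "int (M ! d) \<noteq> best (cnt (A 0))"
    then have "int (\<Sum>r\<le>0. M ! (d - r)) < best (cnt (A 0))" using chA(2)[OF d] by simp
    then have "(\<Sum>s<d. int (\<Sum>r\<le>s. M ! (d - r))) < score d A"
      unfolding score_def using chA(2) d by (intro sum_strict_mono_ex1) (auto intro!: bexI[of _ 0])
    then show False using eq by simp
  qed
  moreover have "best (cnt (C 0)) \<le> best (cnt (A 0))"
    using B(2) BA by (intro optimal_chain_bottom[OF chA(1) chC(1) d]) force
  ultimately show ?thesis using chC(2)[OF d] by simp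
qed

end

section \<open>The modest tuple\<close>

lemma U_set_0: "U_set p q 0 k = {[k]}"
  by (auto simp: U_set_def sums_without_carry_def length_Suc_conv)

text \<open>This recursion drives the inductions on \<open>d\<close>: the digits of
  \<open>k - j\<close> are the digitwise differences, so the other entries again add up without
  carries.\<close>

lemma U_set_snoc:
  assumes "2 \<le> p"
  shows "m @ [j] \<in> U_set p q (Suc d) k \<longleftrightarrow>
    0 < j \<and> (q - 1) dvd j \<and> (\<forall>i. digit p j i \<le> digit p k i) \<and> m \<in> U_set p q d (k - j)"
    (is "?L \<longleftrightarrow> ?R")
proof (cases "length m = d + 1")
  case len: True
  have cond: "(\<forall>i\<in>{1..Suc d}. 0 < (m @ [j]) ! i \<and> (q - 1) dvd (m @ [j]) ! i) \<longleftrightarrow>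
      (\<forall>i\<in>{1..d}. 0 < m ! i \<and> (q - 1) dvd m ! i) \<and> 0 < j \<and> (q - 1) dvd j"
    using len by (auto simp: nth_append atLeastAtMostSuc_conv)
  have sums: "sums_without_carry p (m @ [j]) k \<longleftrightarrow>
      (\<forall>i. digit p j i \<le> digit p k i) \<and> sums_without_carry p m (k - j)"
  proof
    assume s: "sums_without_carry p (m @ [j]) k"
    then have "\<forall>i. (\<Sum>x\<leftarrow>m. digit p x i) + digit p j i = digit p k i" and sum: "sum_list m + j = k"
      by (simp_all add: sums_without_carry_def)
    moreover from this have le: "\<forall>i. digit p j i \<le> digit p k i" by (metis le_add2)
    ultimately show "(\<forall>i. digit p j i \<le> digit p k i) \<and> sums_without_carry p m (k - j)"
      using digitwise_le_diff[OF assms le] by (auto simp: sums_without_carry_def) (metis add_diff_cancel_right')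
  next
    assume s: "(\<forall>i. digit p j i \<le> digit p k i) \<and> sums_without_carry p m (k - j)"
    then show "sums_without_carry p (m @ [j]) k"
      using digitwise_le_diff[OF assms, of j k] by (auto simp: sums_without_carry_def)
  qed
  show ?thesis unfolding U_set_def using len cond sums by auto
next
  case False
  then show ?thesis by (auto simp: U_set_def)
qed

lemma U_set_SucE:
  assumes "m \<in> U_set p q (Suc d) k"
  obtains m' j where "m = m' @ [j]"
  using assms by (cases m rule: rev_cases) (auto simp: U_set_def)

lemma finite_U_set: "finite (U_set p q d k)"
proof (rule finite_subset)
  show "U_set p q d k \<subseteq> {m. set m \<subseteq> {..k} \<and> length m = d + 1}"
    by (auto simp: U_set_def sums_without_carry_def member_le_sum_list)
  show "finite {m. set m \<subseteq> {..k} \<and> length m = d + 1}"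
    by (rule finite_lists_length_eq) simp
qed

lemma tuple_score_snoc: "tuple_score (m @ [j]) = tuple_score m + length m * j"
  by (simp add: tuple_score_def nth_append)

text \<open>The reversed order compares last entries first; once these agree, it compares the
  prefixes.\<close>

lemma modest_snoc:
  assumes "2 \<le> p" "modest p q (Suc d) k (M @ [j])"
  shows "modest p q d (k - j) M"
  unfolding modest_def
proof (intro conjI ballI impI)
  have U: "M @ [j] \<in> U_set p q (Suc d) k" using assms(2) by (simp add: modest_def)
  then show "M \<in> U_set p q d (k - j)" using U_set_snoc[OF assms(1)] by blast
  fix m assume m: "m \<in> U_set p q d (k - j)" "m \<noteq> M"
  then have "m @ [j] \<in> U_set p q (Suc d) k" using U U_set_snoc[OF assms(1)] by blast
  then have "(rev (m @ [j]), rev (M @ [j])) \<in> lexord less_than"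
    using assms(2) m(2) by (auto simp: modest_def simp del: rev_append)
  then show "(rev m, rev M) \<in> lexord less_than" by simp
qed

lemma modest_last_ge:
  assumes "modest p q (Suc d) k (M @ [j])" "m @ [i] \<in> U_set p q (Suc d) k"
  shows "i \<le> j"
proof (cases "m @ [i] = M @ [j]")
  case False
  then have "(rev (m @ [i]), rev (M @ [j])) \<in> lexord less_than"
    using assms by (auto simp: modest_def simp del: rev_append)
  then show ?thesis by auto
qed simp

text \<open>Greedy choice: the largest last entry that occurs, preceded by a modest prefix.\<close>

lemma ex_modest:
  assumes "2 \<le> p" "U_set p q d k \<noteq> {}"
  shows "\<exists>M. modest p q d k M"
  using assms(2)
proof (induction d arbitrary: k)
  case 0
  show ?case by (rule exI[of _ "[k]"]) (simp add: modest_def U_set_0)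
next
  case (Suc d)
  define J where "J = last ` U_set p q (Suc d) k"
  have "finite J" "J \<noteq> {}" using finite_U_set Suc.prems by (simp_all add: J_def)
  then have "Max J \<in> J" by (rule Max_in)
  then obtain x where x: "x \<in> U_set p q (Suc d) k" "Max J = last x" unfolding J_def by blast
  obtain m j where "x = m @ [j]" using x(1) by (rule U_set_SucE)
  then have m: "m @ [Max J] \<in> U_set p q (Suc d) k" using x by simp
  then have "m \<in> U_set p q d (k - Max J)" using U_set_snoc[OF assms(1)] by blast
  then obtain M where M: "modest p q d (k - Max J) M" using Suc.IH by blast
  have "modest p q (Suc d) k (M @ [Max J])"
    unfolding modest_def
  proof (intro conjI ballI impI)
    show "M @ [Max J] \<in> U_set p q (Suc d) k"
      using M m U_set_snoc[OF assms(1)] by (auto simp: modest_def)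
    fix x assume x: "x \<in> U_set p q (Suc d) k" "x \<noteq> M @ [Max J]"
    obtain x' j where xj: "x = x' @ [j]" using x(1) by (rule U_set_SucE)
    have "j \<in> J" using x(1) by (force simp: J_def xj)
    then have "j \<le> Max J" using \<open>finite J\<close> by simp
    moreover have "(rev x', rev M) \<in> lexord less_than" if "j = Max J"
      using that M x U_set_snoc[OF assms(1)] by (auto simp: modest_def xj)
    ultimately show "(rev x, rev (M @ [Max J])) \<in> lexord less_than"
      by (cases "j = Max J") (auto simp: xj)
  qed
  then show ?case by blast
qed

lemma modest_unique:
  assumes "modest p q d k M" "modest p q d k M'"
  shows "M = M'"
proof (rule ccontr)
  assume "M \<noteq> M'"
  then have "(rev M, rev M') \<in> lexord less_than" "(rev M', rev M) \<in> lexord less_than"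
    using assms by (auto simp: modest_def)
  then show False
    using lexord_asymmetric[of less_than "rev M" "rev M'"] by (simp add: asym_less_than)
qed

text \<open>The last entries bound each other, by optimality in one direction and by modesty in the
  other. With the last entry fixed, score and prefix score differ by a constant, so the prefix is
  optimal again.\<close>

lemma optimal_eq_modest:
  assumes "2 \<le> p" "0 < f" "modest p (p ^ f) d k M" "m \<in> U_set p (p ^ f) d k"
    and "\<And>x. x \<in> U_set p (p ^ f) d k \<Longrightarrow> tuple_score x \<le> tuple_score m"
  shows "m = M"
  using assms(3-)
proof (induction d arbitrary: k m M)
  case 0 then show ?case by (simp add: modest_def U_set_0)
next
  case (Suc d)
  let ?q = "p ^ f"
  have M: "M \<in> U_set p ?q (Suc d) k" using Suc.prems(1) by (simp add: modest_def)
  obtain M' j where Mj: "M = M' @ [j]" using M by (rule U_set_SucE)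
  obtain m' i where mi: "m = m' @ [i]" using Suc.prems(2) by (rule U_set_SucE)
  have len: "length m = Suc d + 1" "length M = Suc d + 1" using Suc.prems(2) M by (auto simp: U_set_def)
  \<comment> \<open>The digit bound \<open>K\<close> may be \<open>k\<close> itself since
    \<open>k < p ^ k\<close>.\<close>
  interpret digit_classes p f k k
    using assms(1,2) by unfold_locales (auto simp: power_gt_expt)
  have "M ! Suc d \<le> m ! Suc d"
    using optimal_tuple_last[OF Suc.prems(2,3) M] by simp
  then have "j \<le> i" using len by (simp add: Mj mi nth_append)
  moreover have "i \<le> j" using modest_last_ge Suc.prems(1,2) by (simp add: Mj mi)
  ultimately have ij: "i = j" by simp
  have "m' = M'"
  proof (rule Suc.IH)
    show "modest p ?q d (k - j) M'" using modest_snoc[OF assms(1)] Suc.prems(1) by (simp add: Mj)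
    show "m' \<in> U_set p ?q d (k - j)" using U_set_snoc[OF assms(1)] Suc.prems(2) by (simp add: mi ij)
    fix x assume x: "x \<in> U_set p ?q d (k - j)"
    then have "x @ [j] \<in> U_set p ?q (Suc d) k"
      using U_set_snoc[OF assms(1)] M by (simp add: Mj)
    then have "tuple_score (x @ [j]) \<le> tuple_score (m' @ [j])" using Suc.prems(3) by (simp add: mi ij)
    moreover have "length x = length m'" using x len by (simp add: U_set_def mi)
    ultimately show "tuple_score x \<le> tuple_score m'" by (simp add: tuple_score_snoc)
  qed
  then show ?case by (simp add: Mj mi ij)
qed

lemma t_exponent_add_tuple_score:
  assumes "m \<in> U_set p q d k"
  shows "t_exponent d m + tuple_score m = d * k"
proof -
  have len: "length m = Suc d" and sum: "sum_list m = k"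
    using assms by (auto simp: U_set_def sums_without_carry_def)
  have "t_exponent d m + tuple_score m = (\<Sum>i<Suc d. (d - i) * m ! i) + (\<Sum>i<Suc d. i * m ! i)"
    by (simp add: t_exponent_def tuple_score_def len)
  also have "\<dots> = (\<Sum>i<Suc d. d * m ! i)"
    unfolding sum.distrib[symmetric]
    by (intro sum.cong refl) (auto simp: add_mult_distrib[symmetric])
  also have "\<dots> = d * k"
    using sum by (simp only: sum_list_lessThan len sum_distrib_left[symmetric])
  finally show ?thesis .
qed

text \<open>Every tuple of maximal score equals \<open>M\<close>, so a different tuple cannot tie
  with it.\<close>

lemma modest_t_exponent_less:
  assumes "2 \<le> p" "0 < f" "modest p (p ^ f) d k M" "m \<in> U_set p (p ^ f) d k" "m \<noteq> M"
  shows "t_exponent d M < t_exponent d m"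
proof -
  let ?U = "U_set p (p ^ f) d k"
  have M: "M \<in> ?U" using assms(3) by (simp add: modest_def)
  have fin: "finite (tuple_score ` ?U)" "tuple_score ` ?U \<noteq> {}" using finite_U_set assms(4) by auto
  obtain x where x: "x \<in> ?U" "tuple_score x = Max (tuple_score ` ?U)" using Max_in[OF fin] by force
  have opt: "tuple_score y \<le> tuple_score x" if "y \<in> ?U" for y
    using that fin(1) x(2) by simp
  have "x = M" using optimal_eq_modest[OF assms(1-3) x(1) opt] .
  have "tuple_score m \<noteq> tuple_score M"
  proof
    assume "tuple_score m = tuple_score M"
    then have "m = M" using optimal_eq_modest[OF assms(1-4)] opt \<open>x = M\<close> by simp
    then show False using assms(5) by simp
  qed
  then have "tuple_score m < tuple_score M" using opt[OF assms(4)] \<open>x = M\<close> by simp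
  then show ?thesis
    using t_exponent_add_tuple_score[OF M] t_exponent_add_tuple_score[OF assms(4)] by linarith
qed

section \<open>Power sums\<close>

lemma CHAR_eq_prime:
  assumes "prime p" "CARD('a::{field,finite}) = p ^ f"
  shows "CHAR('a) = p"
proof -
  \<comment> \<open>Translation by \<open>1\<close> permutes the field, so its cardinality is zero
    as a field element.\<close>
  have "(\<Sum>x\<in>UNIV. x + 1) = (\<Sum>x\<in>UNIV. x :: 'a)"
    by (rule sum.reindex_bij_witness[of _ "\<lambda>x. x - 1" "\<lambda>x. x + 1"]) auto
  then have "of_nat CARD('a) = (0 :: 'a)" by (simp add: sum.distrib)
  then have "CHAR('a) dvd p ^ f" using assms(2) by (metis of_nat_eq_0_iff_char_dvd)
  moreover have "0 < CHAR('a)" by (rule finite_imp_CHAR_pos) simp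
  then have "prime CHAR('a)" by (rule prime_CHAR_semidom)
  ultimately show ?thesis using assms(1) by (metis prime_dvd_power primes_dvd_imp_eq)
qed

lemma power_card_minus_1:
  fixes x :: "'a::{field,finite}"
  assumes "x \<noteq> 0"
  shows "x ^ (CARD('a) - 1) = 1"
proof -
  have "(\<Prod>y\<in>UNIV - {0}. x * y) = (\<Prod>y\<in>UNIV - {0}. y)"
    by (rule prod.reindex_bij_witness[of _ "\<lambda>y. y / x" "\<lambda>y. x * y"]) (use assms in auto)
  then have "x ^ card (UNIV - {0::'a}) * (\<Prod>y\<in>UNIV - {0}. y) = (\<Prod>y\<in>UNIV - {0}. y)"
    by (simp add: prod.distrib)
  moreover have "(\<Prod>y\<in>UNIV - {0}. y) \<noteq> (0 :: 'a)" by simp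
  ultimately show ?thesis by (simp add: card_Diff_singleton)
qed

text \<open>Substituting \<open>g * x\<close> for \<open>x\<close> multiplies the sum by
  \<open>g ^ j\<close>, so it vanishes if some nonzero \<open>g\<close> has
  \<open>g ^ j \<noteq> 1\<close>. For positive multiples of \<open>CARD('a) - 1\<close> all nonzero
  terms are \<open>1\<close>; for \<open>j = 0\<close> the term \<open>0 ^ 0 = 1\<close> counts too
  and the sum is the cardinality, zero in the field.\<close>

lemma power_sum_UNIV:
  "(\<Sum>x\<in>UNIV. x ^ j :: 'a::{field,finite}) = (if 0 < j \<and> (CARD('a) - 1) dvd j then - 1 else 0)"
proof -
  have "(\<Sum>x\<in>UNIV. x + 1) = (\<Sum>x\<in>UNIV. x :: 'a)"
    by (rule sum.reindex_bij_witness[of _ "\<lambda>x. x - 1" "\<lambda>x. x + 1"]) auto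
  then have card0: "of_nat CARD('a) = (0 :: 'a)" by (simp add: sum.distrib)
  have split0: "(\<Sum>x\<in>UNIV. x ^ j :: 'a) = (\<Sum>x\<in>UNIV - {0}. x ^ j)" if "0 < j"
    using that by (subst sum.remove[of _ 0]) (auto simp: zero_power)
  consider "j = 0" | "0 < j" "(CARD('a) - 1) dvd j" | "\<not> (CARD('a) - 1) dvd j" by auto
  then show ?thesis
  proof cases
    case 1 then show ?thesis using card0 by simp
  next
    case 2
    then obtain c where c: "j = (CARD('a) - 1) * c" by (elim dvdE)
    have "(\<Sum>x\<in>UNIV - {0}. x ^ j :: 'a) = (\<Sum>x\<in>UNIV - {0::'a}. 1)"
      using power_card_minus_1[where ?'a = 'a] by (intro sum.cong refl) (simp add: c power_mult)
    also have "\<dots> = of_nat (CARD('a) - 1)" by (simp add: card_Diff_singleton)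
    also have "\<dots> = - 1"
      using card0 by (subst of_nat_diff) (auto simp: Suc_leI card_gt_0_iff)
    finally show ?thesis using 2 split0 by simp
  next
    case 3
    \<comment> \<open>On nonzero elements only the remainder \<open>r\<close> matters, and
      \<open>X ^ r - 1\<close> has at most \<open>r < CARD('a) - 1\<close> roots.\<close>
    define r where "r = j mod (CARD('a) - 1)"
    have r: "0 < r" unfolding r_def using 3 by (metis mod_eq_0_iff_dvd neq0_conv)
    have "1 < CARD('a)"
    proof -
      have "card {0, 1 :: 'a} \<le> CARD('a)" by (intro card_mono) auto
      then show ?thesis by simp
    qed
    then have r': "r < CARD('a) - 1" unfolding r_def by (intro mod_less_divisor) simp
    have "\<exists>g :: 'a. g \<noteq> 0 \<and> g ^ r \<noteq> 1"
    proof (rule ccontr)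
      assume "\<not> ?thesis"
      then have roots: "x ^ r = 1" if "x \<noteq> 0" for x :: 'a using that by blast
      define P :: "'a poly" where "P = monom 1 r - 1"
      have deg: "degree P \<le> r" unfolding P_def
        by (intro order_trans[OF degree_diff_le_max]) (simp add: degree_monom_le)
      have "P \<noteq> 0"
      proof
        assume "P = 0"
        then have "coeff P r = 0" by simp
        then show False using r by (simp add: P_def)
      qed
      have "UNIV - {0} \<subseteq> {x. poly P x = 0}" using roots by (auto simp: P_def poly_monom)
      then have "card (UNIV - {0::'a}) \<le> card {x. poly P x = 0}"
        by (intro card_mono) auto
      also have "\<dots> \<le> degree P" using \<open>P \<noteq> 0\<close> by (rule card_poly_roots_bound)
      finally show False using deg r' by (simp add: card_Diff_singleton)
    qed
    then obtain g :: 'a where g: "g \<noteq> 0" "g ^ r \<noteq> 1" by blast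
    have gj: "g ^ j = g ^ r"
    proof -
      have "g ^ j = (g ^ (CARD('a) - 1)) ^ (j div (CARD('a) - 1)) * g ^ r"
        unfolding r_def by (simp flip: power_mult power_add)
      then show ?thesis using power_card_minus_1[OF g(1)] by simp
    qed
    have "(\<Sum>x\<in>UNIV. (g * x) ^ j) = (\<Sum>x\<in>UNIV. x ^ j)"
      by (rule sum.reindex_bij_witness[of _ "\<lambda>x. x / g" "\<lambda>x. g * x"]) (use g in auto)
    then have "g ^ j * (\<Sum>x\<in>UNIV. x ^ j) = (\<Sum>x\<in>UNIV. x ^ j)"
      by (simp add: power_mult_distrib sum_distrib_left)
    then show ?thesis using g gj 3 by simp
  qed
qed

section \<open>Lucas' theorem in characteristic \<open>p\<close>\<close>

lemma coeff_one_plus_X_power: "coeff ([:1, 1 :: 'a::comm_ring_1:] ^ n) i = of_nat (n choose i)"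
proof (cases "i \<le> n")
  case True then show ?thesis by (simp add: coeff_linear_poly_power)
next
  case False
  have "degree ([:1, 1 :: 'a:] ^ n) \<le> n"
    by (rule order_trans[OF degree_power_le]) simp
  then show ?thesis using False by (simp add: coeff_eq_0 binomial_eq_0)
qed

text \<open>One digit of Lucas' theorem: compare the coefficients of degree \<open>p * m + s\<close>
  in \<open>(1 + X) ^ (p * n + r) = (1 + X ^ p) ^ n * (1 + X) ^ r\<close>. As \<open>r\<close> and
  \<open>s\<close> are below \<open>p\<close>, only the term \<open>X ^ (p * m)\<close> of the first
  factor contributes.\<close>

lemma choose_mod_prime_step:
  assumes "prime CHAR('a::comm_ring_1)" "p = CHAR('a)" "r < p" "s < p"
  shows "(of_nat ((p * n + r) choose (p * m + s)) :: 'a) = of_nat (n choose m) * of_nat (r choose s)"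
proof -
  have pp: "[:1, 1 :: 'a:] ^ p = monom 1 p + 1"
  proof (rule poly_eqI)
    fix i
    have "(of_nat (p choose i) :: 'a) = 0" if "0 < i" "i < p"
    proof -
      have "p dvd (p choose i)" by (rule dvd_choose_prime) (use that assms in auto)
      then show ?thesis using assms(2) of_nat_eq_0_iff_char_dvd by blast
    qed
    then show "coeff ([:1, 1 :: 'a:] ^ p) i = coeff (monom 1 p + 1) i"
      using assms(3) by (cases "i = 0"; cases "i = p"; cases "i < p")
        (auto simp: coeff_one_plus_X_power binomial_eq_0)
  qed
  have "[:1, 1 :: 'a:] ^ (p * n + r) = (monom 1 p + 1) ^ n * [:1, 1:] ^ r"
    by (simp add: power_add power_mult pp)
  also have "\<dots> = (\<Sum>i\<le>n. of_nat (n choose i) * monom 1 (p * i) * [:1, 1:] ^ r)"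
    unfolding binomial_ring sum_distrib_right
    by (intro sum.cong refl) (simp add: monom_power mult.commute)
  finally have "coeff ([:1, 1 :: 'a:] ^ (p * n + r)) (p * m + s)
      = (\<Sum>i\<le>n. coeff (of_nat (n choose i) * monom 1 (p * i) * [:1, 1:] ^ r) (p * m + s))"
    by (simp add: coeff_sum)
  also have "\<dots> = (\<Sum>i\<le>n. if i = m then of_nat (n choose m) * of_nat (r choose s) else 0)"
  proof (intro sum.cong refl)
    fix i assume "i \<in> {..n}"
    have "coeff (of_nat (n choose i) * monom 1 (p * i) * [:1, 1 :: 'a:] ^ r) (p * m + s)
        = of_nat (n choose i) * coeff (monom 1 (p * i) * [:1, 1 :: 'a:] ^ r) (p * m + s)"
      by (simp add: of_nat_poly mult.assoc)
    also have "\<dots> = (if i = m then of_nat (n choose m) * of_nat (r choose s) else 0)"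
    proof -
      consider "i = m" | "m < i" | "i < m" by linarith
      then show ?thesis
      proof cases
        case 2
        then have "p * (m + 1) \<le> p * i" by (intro mult_le_mono2) simp
        then have "p * m + s < p * i" using assms(4) by simp
        then show ?thesis using 2 by (simp add: coeff_monom_mult)
      next
        case 3
        then have "p * (i + 1) \<le> p * m" by (intro mult_le_mono2) simp
        then have "r < p * m + s - p * i" using assms(3) by simp
        then show ?thesis using 3 by (simp add: coeff_monom_mult coeff_one_plus_X_power binomial_eq_0)
      qed (simp add: coeff_monom_mult coeff_one_plus_X_power)
    qed
    finally show "coeff (of_nat (n choose i) * monom 1 (p * i) * [:1, 1 :: 'a:] ^ r) (p * m + s)
        = (if i = m then of_nat (n choose m) * of_nat (r choose s) else 0)" .
  qed
  also have "\<dots> = of_nat (n choose m) * of_nat (r choose s)"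
    by (cases "m \<le> n") (auto simp: binomial_eq_0)
  finally show ?thesis by (simp add: coeff_one_plus_X_power)
qed

text \<open>Iterate the one-digit step. For single digits \<open>p\<close> does not divide
  \<open>fact (k mod p)\<close>, hence not the binomial coefficient dividing it.\<close>

lemma choose_nonzero_iff_digitwise_le:
  assumes "prime p" "CHAR('a::idom) = p"
  shows "(of_nat (k choose j) :: 'a) \<noteq> 0 \<longleftrightarrow> (\<forall>i. digit p j i \<le> digit p k i)"
proof (induction k arbitrary: j rule: less_induct)
  case (less k)
  have p2: "2 \<le> p" using assms(1) by (rule prime_ge_2_nat)
  then have ml: "x mod p < p" for x by (intro mod_less_divisor) simp
  have step: "(of_nat (k choose j) :: 'a) = of_nat ((k div p) choose (j div p)) * of_nat ((k mod p) choose (j mod p))"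
    using choose_mod_prime_step[where ?'a = 'a and p = p and n = "k div p" and r = "k mod p"
        and m = "j div p" and s = "j mod p"] assms(1) ml unfolding assms(2) mult_div_mod_eq by blast
  have small: "(of_nat ((k mod p) choose (j mod p)) :: 'a) \<noteq> 0 \<longleftrightarrow> j mod p \<le> k mod p"
  proof
    assume le: "j mod p \<le> k mod p"
    have "\<not> p dvd fact (k mod p)" using assms(1) ml[of k] by (simp add: prime_dvd_fact_iff)
    then have "\<not> p dvd ((k mod p) choose (j mod p))"
      using binomial_fact_lemma[OF le] by (metis dvd_mult)
    then show "(of_nat ((k mod p) choose (j mod p)) :: 'a) \<noteq> 0"
      using assms(2) by (simp add: of_nat_eq_0_iff_char_dvd)
  qed (metis binomial_eq_0 not_le of_nat_0)
  show ?case
  proof (cases "k = 0")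
    case True
    show ?thesis
    proof
      assume "(of_nat (k choose j) :: 'a) \<noteq> 0"
      then have "j = 0" using True by (cases j) auto
      then show "\<forall>i. digit p j i \<le> digit p k i" by (simp add: digit_of_0)
    next
      assume "\<forall>i. digit p j i \<le> digit p k i"
      then have "j = 0" using digitwise_le_diff[OF p2] True by blast
      then show "(of_nat (k choose j) :: 'a) \<noteq> 0" by simp
    qed
  next
    case False
    then have "k div p < k" using p2 by simp
    from less.IH[OF this] show ?thesis
      unfolding step digitwise_le_div[of p j k] using small by auto
  qed
qed

section \<open>Multinomial coefficients\<close>

lemma prod_fact_dvd_fact_sum: "(\<Prod>x\<leftarrow>m. fact x :: nat) dvd fact (sum_list m)"
proof (induction m)
  case (Cons a m)
  have "fact a * fact (sum_list m) dvd (fact (a + sum_list m) :: nat)" by (rule fact_fact_dvd_fact)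
  then show ?case using Cons by simp (metis dvd_trans mult_dvd_mono dvd_refl)
qed simp

lemma multinomial_snoc:
  assumes "sum_list m + j = k"
  shows "multinomial k (m @ [j]) = (k choose j) * multinomial (k - j) m"
proof -
  define P :: nat where "P = (\<Prod>x\<leftarrow>m. fact x)"
  have P0: "0 < P" unfolding P_def by (induction m) auto
  have "P dvd fact (k - j)" using prod_fact_dvd_fact_sum[of m] assms by (auto simp: P_def)
  then obtain c where c: "fact (k - j) = P * c" by (elim dvdE)
  have "fact k = fact j * fact (k - j) * (k choose j)"
    using binomial_fact_lemma[of j k] assms by simp
  then have "fact k = (P * fact j) * ((k choose j) * c)" by (simp add: c mult_ac)
  then have "multinomial k (m @ [j]) = (k choose j) * c"
    using P0 by (simp add: multinomial_def flip: P_def)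
  moreover have "multinomial (k - j) m = c"
    using P0 by (simp add: multinomial_def c flip: P_def)
  ultimately show ?thesis by simp
qed

text \<open>Peeling off last entries gives a product of binomial coefficients, each with its lower
  index digitwise below the upper one.\<close>

lemma multinomial_nonzero:
  assumes "prime p" "CHAR('a::idom) = p" "m \<in> U_set p q d k"
  shows "(of_nat (multinomial k m) :: 'a) \<noteq> 0"
  using assms(3)
proof (induction d arbitrary: k m)
  case 0 then show ?case by (simp add: U_set_0 multinomial_def)
next
  case (Suc d)
  obtain m' j where mj: "m = m' @ [j]" using Suc.prems by (rule U_set_SucE)
  have U: "\<forall>i. digit p j i \<le> digit p k i" "m' \<in> U_set p q d (k - j)"
    using Suc.prems U_set_snoc[OF prime_ge_2_nat[OF assms(1)]] by (auto simp: mj)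
  have "sum_list m' + j = k" using Suc.prems by (simp add: mj U_set_def sums_without_carry_def)
  then have "(of_nat (multinomial k m) :: 'a) = of_nat (k choose j) * of_nat (multinomial (k - j) m')"
    by (simp add: mj multinomial_snoc)
  then show ?case
    using Suc.IH[OF U(2)] U(1) choose_nonzero_iff_digitwise_le[OF assms(1,2)] by simp
qed

section \<open>Expansion of sums over monic polynomials\<close>

lemma sum_powers_of_translates:
  fixes b :: "'a::{field,finite} poly"
  shows "(\<Sum>x\<in>UNIV. (b + monom x e) ^ k) =
    - (\<Sum>j | j \<le> k \<and> 0 < j \<and> (CARD('a) - 1) dvd j. monom (of_nat (k choose j)) (e * j) * b ^ (k - j))"
proof -
  have "(\<Sum>x\<in>UNIV. (b + monom x e) ^ k)
      = (\<Sum>x\<in>UNIV. \<Sum>j\<le>k. monom (of_nat (k choose j) * x ^ j) (e * j) * b ^ (k - j))"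
  proof (intro sum.cong refl)
    fix x :: 'a
    have "(b + monom x e) ^ k = (\<Sum>j\<le>k. of_nat (k choose j) * monom x e ^ j * b ^ (k - j))"
      by (subst add.commute) (rule binomial_ring)
    then show "(b + monom x e) ^ k = (\<Sum>j\<le>k. monom (of_nat (k choose j) * x ^ j) (e * j) * b ^ (k - j))"
      by (simp add: of_nat_poly monom_power smult_monom mult.commute)
  qed
  also have "\<dots> = (\<Sum>j\<le>k. \<Sum>x\<in>UNIV. monom (of_nat (k choose j) * x ^ j) (e * j) * b ^ (k - j))"
    by (rule sum.swap)
  also have "\<dots> = (\<Sum>j\<le>k. monom (of_nat (k choose j) * (\<Sum>x\<in>UNIV. x ^ j)) (e * j) * b ^ (k - j))"
    by (simp add: sum_distrib_left sum_distrib_right monom_sum)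
  \<comment> \<open>Summing over \<open>x\<close> removes every \<open>j\<close> that is zero or not
    \<open>q\<close>-even and leaves the factor \<open>- 1\<close> for the others.\<close>
  also have "\<dots> = (\<Sum>j\<le>k. if 0 < j \<and> (CARD('a) - 1) dvd j
      then - (monom (of_nat (k choose j)) (e * j) * b ^ (k - j)) else 0)"
    by (intro sum.cong refl) (simp add: power_sum_UNIV flip: minus_monom)
  also have "\<dots> = (\<Sum>j | j \<le> k \<and> 0 < j \<and> (CARD('a) - 1) dvd j.
      - (monom (of_nat (k choose j)) (e * j) * b ^ (k - j)))"
    by (rule sum.mono_neutral_cong_right) auto
  finally show ?thesis by (simp add: sum_negf)
qed

text \<open>For \<open>n \<le> d\<close> only the \<open>n\<close> coefficients just below the
  leading one are free, which allows summing over one coefficient at a time.\<close>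

definition monics_below :: "nat \<Rightarrow> nat \<Rightarrow> 'a::field poly set" where
  "monics_below d n = {a. degree a = d \<and> lead_coeff a = 1 \<and> (\<forall>i<d - n. coeff a i = 0)}"

lemma monics_below_0: "monics_below d 0 = {monom 1 d :: 'a::field poly}"
proof -
  have "a = monom 1 d" if "degree a = d" "lead_coeff a = 1" "\<forall>i<d. coeff a i = 0" for a :: "'a poly"
  proof (rule poly_eqI)
    fix i show "coeff a i = coeff (monom 1 d) i"
      using that coeff_eq_0[of a i] by (cases i d rule: linorder_cases) auto
  qed
  then show ?thesis by (auto simp: monics_below_def degree_monom_eq)
qed

lemma monics_below_Suc:
  assumes "Suc n \<le> d"
  shows "bij_betw (\<lambda>(b, x). b + monom x (d - Suc n)) (monics_below d n \<times> UNIV)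
    (monics_below d (Suc n) :: 'a::field poly set)"
proof (rule bij_betwI[of _ _ _ "\<lambda>a. (a - monom (coeff a (d - Suc n)) (d - Suc n), coeff a (d - Suc n))"])
  let ?e = "d - Suc n"
  have e: "?e < d" using assms by simp
  have idx: "i < d - n \<longleftrightarrow> i < ?e \<or> i = ?e" for i using assms by auto
  have top: "degree (b + monom x ?e) = d \<and> coeff (b + monom x ?e) d = 1"
    if "degree b = d" "coeff b d = 1" for b :: "'a poly" and x
  proof -
    have "degree (monom x ?e) < degree b" using degree_monom_le[of x ?e] e that by simp
    then have "degree (b + monom x ?e) = d" using that by (simp add: degree_add_eq_left)
    then show ?thesis using that e by simp
  qed
  show "(\<lambda>(b, x). b + monom x ?e) \<in> monics_below d n \<times> UNIV \<rightarrow> (monics_below d (Suc n) :: 'a poly set)"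
  proof (rule funcsetI)
    fix z :: "'a poly \<times> 'a" assume "z \<in> monics_below d n \<times> UNIV"
    then obtain b x where z: "z = (b, x)" "degree b = d" "coeff b d = 1" "\<And>i. i < d - n \<Longrightarrow> coeff b i = 0"
      by (auto simp: monics_below_def)
    then show "(case z of (b, x) \<Rightarrow> b + monom x ?e) \<in> monics_below d (Suc n)"
      using top[OF z(2,3), of x] by (simp add: monics_below_def idx)
  qed
  show "(\<lambda>a. (a - monom (coeff a ?e) ?e, coeff a ?e)) \<in> (monics_below d (Suc n) :: 'a poly set) \<rightarrow> monics_below d n \<times> UNIV"
  proof
    fix a :: "'a poly" assume "a \<in> monics_below d (Suc n)"
    then have a: "degree a = d" "coeff a d = 1" "\<And>i. i < ?e \<Longrightarrow> coeff a i = 0"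
      by (auto simp: monics_below_def)
    define b where "b = a - monom (coeff a ?e) ?e"
    have "b = a + monom (- coeff a ?e) ?e" by (simp add: b_def flip: minus_monom)
    then have "degree b = d" "coeff b d = 1" using top[OF a(1,2)] by blast+
    moreover have "coeff b i = 0" if "i < d - n" for i
      using that a(3) by (auto simp: idx b_def)
    ultimately have "b \<in> monics_below d n" by (simp add: monics_below_def)
    then show "(a - monom (coeff a ?e) ?e, coeff a ?e) \<in> monics_below d n \<times> UNIV"
      by (simp add: b_def)
  qed
qed (use assms in \<open>auto simp: monics_below_def\<close>)

text \<open>Each newly freed coefficient appends a last entry to the tuples and contributes a sign.
  The binomial coefficients surviving modulo \<open>p\<close> are those satisfying the digit
  condition of \<open>U_set_snoc\<close>.\<close>

lemma sum_monics_below_power: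
  fixes p f d :: nat
  assumes p: "prime p" and card: "CARD('a::{field,finite}) = p ^ f" and n: "n \<le> d"
  shows "(\<Sum>a\<in>monics_below d n. a ^ k) = (- 1) ^ n * (\<Sum>m\<in>U_set p (p ^ f) n k.
    monom (of_nat (multinomial k m) :: 'a) (\<Sum>i<length m. (d - i) * m ! i))"
  using n
proof (induction n arbitrary: k)
  case 0
  show ?case by (simp add: monics_below_0 U_set_0 multinomial_def monom_power)
next
  case (Suc n)
  have p2: "2 \<le> p" using p by (rule prime_ge_2_nat)
  define e where "e = d - Suc n"
  define q where "q = p ^ f"
  define J where "J = {j. j \<le> k \<and> 0 < j \<and> (q - 1) dvd j}"
  define J' where "J' = {j \<in> J. \<forall>i. digit p j i \<le> digit p k i}"
  \<comment> \<open>The exponents count down from the full degree \<open>d\<close>, although at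
    stage \<open>n\<close> the tuples have only \<open>n + 1\<close> entries.\<close>
  define w where "w l m = (\<Sum>i<length m. (d - i) * m ! i)" for l :: nat and m
  define t where "t l m = monom (of_nat (multinomial l m) :: 'a) (w l m)" for l m
  have finJ: "finite J" by (simp add: J_def)
  have "(\<Sum>a\<in>monics_below d (Suc n). a ^ k)
      = (\<Sum>(b, x)\<in>monics_below d n \<times> UNIV. (b + monom x e) ^ k :: 'a poly)"
    using sum.reindex_bij_betw[OF monics_below_Suc[OF Suc.prems, where ?'a = 'a], of "\<lambda>a. a ^ k"]
    by (simp add: e_def case_prod_unfold)
  also have "\<dots> = (\<Sum>b\<in>monics_below d n. \<Sum>x\<in>UNIV. (b + monom x e) ^ k)"
    by (simp add: sum.cartesian_product)
  also have "\<dots> = - (\<Sum>b\<in>monics_below d n. \<Sum>j\<in>J. monom (of_nat (k choose j)) (e * j) * b ^ (k - j))"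
    by (simp add: sum_powers_of_translates card J_def q_def sum_negf)
  also have "\<dots> = - (\<Sum>j\<in>J. \<Sum>b\<in>monics_below d n. monom (of_nat (k choose j)) (e * j) * b ^ (k - j))"
    by (subst sum.swap) simp
  also have "\<dots> = - (\<Sum>j\<in>J. monom (of_nat (k choose j)) (e * j) * ((- 1) ^ n * (\<Sum>m\<in>U_set p q n (k - j). t (k - j) m)))"
    using Suc by (simp add: t_def w_def q_def flip: sum_distrib_left)
  also have "\<dots> = (- 1) ^ Suc n * (\<Sum>j\<in>J. monom (of_nat (k choose j)) (e * j) * (\<Sum>m\<in>U_set p q n (k - j). t (k - j) m))"
  proof -
    have "(\<Sum>j\<in>J. X j * ((- 1) ^ n * Y j)) = (- 1) ^ n * (\<Sum>j\<in>J. X j * Y j)"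
      for X Y :: "nat \<Rightarrow> 'a poly"
      unfolding sum_distrib_left by (intro sum.cong refl mult.left_commute)
    then show ?thesis by simp
  qed
  also have "(\<Sum>j\<in>J. monom (of_nat (k choose j)) (e * j) * (\<Sum>m\<in>U_set p q n (k - j). t (k - j) m))
      = (\<Sum>j\<in>J'. \<Sum>m\<in>U_set p q n (k - j). monom (of_nat (k choose j)) (e * j) * t (k - j) m)"
    unfolding sum_distrib_left
  proof (rule sum.mono_neutral_right[OF finJ])
    show "J' \<subseteq> J" by (auto simp: J'_def)
    show "\<forall>j\<in>J - J'. (\<Sum>m\<in>U_set p q n (k - j). monom (of_nat (k choose j)) (e * j) * t (k - j) m) = 0"
    proof
      fix j assume "j \<in> J - J'"
      then have "(of_nat (k choose j) :: 'a) = 0"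
        using choose_nonzero_iff_digitwise_le[OF p CHAR_eq_prime[OF p card]] by (auto simp: J'_def)
      then show "(\<Sum>m\<in>U_set p q n (k - j). monom (of_nat (k choose j)) (e * j) * t (k - j) m) = 0"
        by simp
    qed
  qed
  also have "\<dots> = (\<Sum>(j, m)\<in>(SIGMA j:J'. U_set p q n (k - j)). monom (of_nat (k choose j)) (e * j) * t (k - j) m)"
    using finJ by (intro sum.Sigma) (auto simp: J'_def finite_U_set)
  also have "\<dots> = (\<Sum>m\<in>U_set p q (Suc n) k. t k m)"
  proof (rule sum.reindex_bij_witness[of _ "\<lambda>m. (last m, butlast m)" "\<lambda>(j, m). m @ [j]"])
    fix a assume a: "a \<in> (SIGMA j:J'. U_set p q n (k - j))"
    then obtain j m where jm: "a = (j, m)" "j \<in> J'" "m \<in> U_set p q n (k - j)" by auto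
    show "(last (case a of (j, m) \<Rightarrow> m @ [j]), butlast (case a of (j, m) \<Rightarrow> m @ [j])) = a"
      by (simp add: jm)
    show "(case a of (j, m) \<Rightarrow> m @ [j]) \<in> U_set p q (Suc n) k"
      using jm by (simp add: U_set_snoc[OF p2] J'_def J_def)
    have len: "length m = Suc n" and "sum_list m + j = k"
      using jm by (auto simp: U_set_def sums_without_carry_def J'_def J_def)
    have "w k (m @ [j]) = w (k - j) m + e * j"
      by (simp add: w_def e_def len nth_append)
    then show "t k (case a of (j, m) \<Rightarrow> m @ [j]) = (case a of (j, m) \<Rightarrow> monom (of_nat (k choose j)) (e * j) * t (k - j) m)"
      using multinomial_snoc[OF \<open>sum_list m + j = k\<close>] by (simp add: jm t_def mult_monom add.commute)
  next
    fix m assume m: "m \<in> U_set p q (Suc n) k"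
    obtain m' j where mj: "m = m' @ [j]" using m by (rule U_set_SucE)
    show "(case (last m, butlast m) of (j, m) \<Rightarrow> m @ [j]) = m" by (simp add: mj)
    have U: "0 < j" "(q - 1) dvd j" "\<forall>i. digit p j i \<le> digit p k i" "m' \<in> U_set p q n (k - j)"
      using m U_set_snoc[OF p2] by (auto simp: mj)
    then show "(last m, butlast m) \<in> (SIGMA j:J'. U_set p q n (k - j))"
      using digitwise_le_diff[OF p2 U(3)] by (simp add: mj J'_def J_def)
  qed
  finally show ?case by (simp add: t_def w_def q_def)
qed

theorem theorem2p8:
  fixes p f q d :: nat and s :: int
  assumes "prime p" and "q = p ^ f" and "CARD('a::{field,finite}) = q"
    and "s < 0"
    and "(power_sum d s :: 'a poly fract) \<noteq> 0"
  shows
    "(power_sum d s :: 'a poly fract) =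
       to_fract ((- 1) ^ d * (\<Sum>m\<in>U_set p q d (nat (- s)). summand d (nat (- s)) m))
     \<and> (\<forall>m\<in>U_set p q d (nat (- s)). (summand d (nat (- s)) m :: 'a poly) \<noteq> 0)
     \<and> (\<exists>!M. modest p q d (nat (- s)) M)
     \<and> (\<forall>M. modest p q d (nat (- s)) M \<longrightarrow>
          (\<forall>m\<in>U_set p q d (nat (- s)). m \<noteq> M \<longrightarrow>
             degree (summand d (nat (- s)) M :: 'a poly) < degree (summand d (nat (- s)) m :: 'a poly)
             \<and> t_exponent d M < t_exponent d m))"
proof -
  define k where "k = nat (- s)"
  have p2: "2 \<le> p" using assms(1) by (rule prime_ge_2_nat)
  have card: "CARD('a) = p ^ f" using assms(2,3) by simp
  have f: "0 < f"
  proof (rule ccontr)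
    assume "\<not> 0 < f"
    moreover have "card {0, 1 :: 'a} \<le> CARD('a)" by (intro card_mono) auto
    ultimately show False using card by simp
  qed
  have "power_sum d s = to_fract (\<Sum>a\<in>monics d. a ^ k :: 'a poly)"
  proof -
    have "to_fract (a :: 'a poly) powi (- s) = to_fract (a ^ k)" for a
    proof -
      have "to_fract (a ^ i) = to_fract a ^ i" for i by (induction i) simp_all
      then show ?thesis using assms(4) by (simp add: power_int_def k_def)
    qed
    then show ?thesis by (simp add: power_sum_def)
  qed
  also have "(\<Sum>a\<in>monics d. a ^ k :: 'a poly) = (- 1) ^ d * (\<Sum>m\<in>U_set p q d k. summand d k m)"
  proof -
    have "monics d = (monics_below d d :: 'a poly set)" by (simp add: monics_def monics_below_def)
    moreover have "(\<Sum>i<length m. (d - i) * m ! i) = t_exponent d m" if "m \<in> U_set p q d k" for m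
      using that by (simp add: U_set_def t_exponent_def)
    ultimately show ?thesis
      using sum_monics_below_power[OF assms(1) card order_refl[of d], of k] assms(2)
      by (simp add: summand_def cong: sum.cong)
  qed
  finally have eq: "power_sum d s = to_fract ((- 1) ^ d * (\<Sum>m\<in>U_set p q d k. summand d k m :: 'a poly))" .
  have nz: "(of_nat (multinomial k m) :: 'a) \<noteq> 0" if "m \<in> U_set p q d k" for m
    using multinomial_nonzero[OF assms(1) CHAR_eq_prime[OF assms(1) card] that] .
  \<comment> \<open>An empty index set would make the power sum zero.\<close>
  have "U_set p q d k \<noteq> {}" using eq assms(5) by auto
  then obtain M where "modest p q d k M" using ex_modest[OF p2] by blast
  then have "\<exists>!M. modest p q d k M" using modest_unique by blast
  moreover have "degree (summand d k M :: 'a poly) < degree (summand d k m :: 'a poly) \<and> t_exponent d M < t_exponent d m"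
    if "modest p q d k M" "m \<in> U_set p q d k" "m \<noteq> M" for M m
    using modest_t_exponent_less[OF p2 f] that nz assms(2)
    by (simp add: summand_def degree_monom_eq modest_def)
  ultimately show ?thesis
    using eq nz unfolding k_def[symmetric] by (simp add: summand_def)
qed

end
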